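(* Let $H$ be a fixed graph which is not the disjoint union of $P_3$ and $P_1$ together with an arbitrary number (possibly zero) of isolated vertices, where $P_\ell$ denotes the path with $\ell$ edges. Then there exists $b=b(H)>0$ such that $g(n,H)=\Omega(n^b)$ if and only if $H$ has at least $5$ edges, or $H$ has exactly $4$ edges and is triangle-free.
   Context: For a positive integer $n$ and a graph $H$: for each vertex $v$ of the complete graph $K_n$ let $f_v$ be a (not necessarily proper) colouring of the edges of the same $K_n$. The collection $\{f_v\}$ is called $(n,H)$-local if for every copy $T$ of $H$ in $K_n$ (i.e. every subgraph of $K_n$ isomorphic to $H$), there exists a vertex $u\in V(T)$ such that all edges of $T$ receive pairwise different colours in $f_u$. $g(n,H)$ is the smallest $k$ for which there is an $(n,H)$-local collection of colourings each using at most $k$ colours. *)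

theory Defs
  imports "HOL-Library.Ramsey" "HOL-Library.Landau_Symbols"
begin

datatype 'a graph = Graph (verts: "'a set") (edges: "'a set set")

text \<open>\<open>nsets V 2\<close> is the set of all two-element subsets of \<open>V\<close>. Graphs are finite, simple and
  have at least one vertex.\<close>

definition sgraph :: "'a graph \<Rightarrow> bool" where
  "sgraph G \<longleftrightarrow> finite (verts G) \<and> verts G \<noteq> {} \<and> edges G \<subseteq> nsets (verts G) 2"

definition graph_iso :: "'a graph \<Rightarrow> 'b graph \<Rightarrow> bool" where
  "graph_iso G H \<longleftrightarrow> (\<exists>\<phi>. bij_betw \<phi> (verts G) (verts H) \<and> (\<lambda>e. \<phi> ` e) ` edges G = edges H)"

definition subgraph :: "'a graph \<Rightarrow> 'a graph \<Rightarrow> bool" where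
  "subgraph T G \<longleftrightarrow> verts T \<subseteq> verts G \<and> edges T \<subseteq> edges G \<and> edges T \<subseteq> nsets (verts T) 2"

definition copy_in :: "'b graph \<Rightarrow> 'a graph \<Rightarrow> 'a graph \<Rightarrow> bool" where
  "copy_in H G T \<longleftrightarrow> subgraph T G \<and> graph_iso H T"

definition complete_graph :: "nat \<Rightarrow> nat graph" where
  "complete_graph n = Graph {..<n} (nsets {..<n} 2)"

definition empty_graph :: "nat \<Rightarrow> nat graph" where
  "empty_graph m = Graph {..<m} {}"

text \<open>The path with \<open>l\<close> edges, hence with \<open>l + 1\<close> vertices.\<close>

definition path_graph :: "nat \<Rightarrow> nat graph" where
  "path_graph l = Graph {..l} {{i, Suc i} | i. i < l}"

definition disjoint_union :: "'a graph \<Rightarrow> 'b graph \<Rightarrow> ('a + 'b) graph" where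
  "disjoint_union G H = Graph (verts G <+> verts H)
     ((\<lambda>e. Inl ` e) ` edges G \<union> (\<lambda>e. Inr ` e) ` edges H)"

definition triangle_free :: "'a graph \<Rightarrow> bool" where
  "triangle_free G \<longleftrightarrow> (\<nexists>T. copy_in (complete_graph 3) G T)"

text \<open>An edge colouring of \<open>K\<^sub>n\<close> is a function on sets of vertices, of which only the values on
  edges of \<open>K\<^sub>n\<close> matter; colours are natural numbers. Injectivity of \<open>f u\<close> on the edges of \<open>T\<close>
  says that \<open>T\<close> is rainbow in \<open>f u\<close>.\<close>

definition local_collection ::
  "nat \<Rightarrow> 'a graph \<Rightarrow> (nat \<Rightarrow> nat set \<Rightarrow> nat) \<Rightarrow> bool" where
  "local_collection n H f \<longleftrightarrow>
     (\<forall>T. copy_in H (complete_graph n) T \<longrightarrow> (\<exists>u\<in>verts T. inj_on (f u) (edges T)))"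

definition uses_at_most :: "nat \<Rightarrow> (nat \<Rightarrow> nat set \<Rightarrow> nat) \<Rightarrow> nat \<Rightarrow> bool" where
  "uses_at_most n f k \<longleftrightarrow>
     (\<forall>v\<in>verts (complete_graph n). card (f v ` edges (complete_graph n)) \<le> k)"

definition g :: "nat \<Rightarrow> 'a graph \<Rightarrow> nat" where
  "g n H = (LEAST k. \<exists>f. local_collection n H f \<and> uses_at_most n f k)"

text \<open>The minimum in the definition of \<open>g\<close> is attained: give all edges different colours.\<close>

lemma g_attained:
  assumes "sgraph H"
  shows "\<exists>f. local_collection n H f \<and> uses_at_most n f (g n H)"
proof -
  let ?E = "nsets {..<n} (2::nat)"
  have "finite ?E" by (simp add: finite_imp_finite_nsets)
  then obtain c :: "nat set \<Rightarrow> nat" where c: "inj_on c ?E"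
    by (metis finite_imp_inj_to_nat_seg)
  have "local_collection n H (\<lambda>_. c)"
    unfolding local_collection_def
  proof (intro allI impI)
    fix T assume T: "copy_in H (complete_graph n) T"
    then have "edges T \<subseteq> ?E"
      by (simp add: copy_in_def subgraph_def complete_graph_def)
    then have "inj_on c (edges T)" by (rule inj_on_subset[OF c])
    moreover have "verts T \<noteq> {}"
      using T assms by (auto simp: copy_in_def graph_iso_def sgraph_def bij_betw_def)
    ultimately show "\<exists>u\<in>verts T. inj_on c (edges T)" by blast
  qed
  moreover have "uses_at_most n (\<lambda>_. c) (card (c ` ?E))"
    by (simp add: uses_at_most_def complete_graph_def)
  ultimately have "\<exists>k f. local_collection n H f \<and> uses_at_most n f k"
    by (intro exI conjI)
  then show ?thesis unfolding g_def by (rule LeastI_ex)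
qed

end

theory Submission
  imports Defs "HOL-Computational_Algebra.Polynomial" "HOL-Computational_Algebra.Primes"
begin

text \<open>Polynomial lower bound. Find two disjoint ``twin'' parts of \<open>H\<close> (two vertices with a common
  neighbour, or two disjoint edges). Reserve a pool of vertices of size polynomial in the number \<open>k\<close>
  of colours. Every placement of one twin outside the pool admits, by pigeonhole, a placement of the
  rest of \<open>H\<close> inside the pool for which the vertices of the twin see two edges of equal colour. There
  are only polynomially many placements of the rest and of colour patterns of the edge at the twin as
  seen from the rest, so if \<open>n\<close> is a large power of \<open>k\<close> two twins agree in both. Placing both of them
  gives a copy of \<open>H\<close> that is rainbow for none of its vertices. Every graph of the theorem contains
  such twins.

  Subpolynomial upper bound. Identify the vertices of \<open>K\<^sub>n\<close>, \<open>n = p\<^sup>d\<close>, with the leaves of a \<open>p\<close>-ary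
  tree of depth \<open>d\<close>. Let \<open>f\<^sub>u\<close> colour the edge \<open>ux\<close> by the branch of \<open>x\<close> as seen from \<open>u\<close>, and
  colour \<open>xy\<close> by the branches of \<open>x\<close> and \<open>y\<close>. This makes each small graph rainbow
  for one of its vertices unless four vertices \<open>x, y\<close> and \<open>z, w\<close> lie in two separate subtrees. There a
  colouring in the spirit of the superpolynomial lower bound for the grid Ramsey problem (Conlon, Fox,
  Lee and Sudakov) is added: either the pair \<open>xy\<close> distinguishes \<open>z\<close> from \<open>w\<close>, or \<open>zw\<close> distinguishes
  \<open>x\<close> from \<open>y\<close>. For fixed \<open>d\<close> this uses \<open>O(p\<^sup>4) = O(n\<^bsup>4/d\<^esup>)\<close> colours.\<close>

section \<open>Separating pairs by pairs\<close>

lemma nsets_2E: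
  assumes "e \<in> nsets V 2"
  obtains x y where "e = {x, y}" "x \<noteq> y" "x \<in> V" "y \<in> V"
  using assms by (auto simp: nsets_2_eq)

lemma nsets_2_memE:
  assumes "e \<in> nsets V 2" "x \<in> e"
  obtains y where "e = {x, y}" "x \<noteq> y" "x \<in> V" "y \<in> V"
proof -
  from assms(1) obtain u v where uv: "e = {u, v}" "u \<noteq> v" "u \<in> V" "v \<in> V"
    by (auto simp: nsets_2_eq)
  show ?thesis
  proof (cases "x = u")
    case True
    with uv show ?thesis by (intro that[of v]) auto
  next
    case False
    with uv assms(2) show ?thesis by (intro that[of u]) auto
  qed
qed

section \<open>Roots of polynomials modulo a prime\<close>

text \<open>Lagrange's theorem, where \<open>\<not> [:p:] dvd q\<close> says that \<open>q\<close>
  is nonzero modulo \<open>p\<close>. Splitting off a root \<open>c\<close> by synthetic division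
  leaves a remainder divisible by \<open>p\<close>, so the quotient is again nonzero modulo
  \<open>p\<close>, and primality passes every root other than \<open>c\<close> on to it.\<close>

lemma card_roots_mod_prime_le_degree:
  fixes q :: "int poly"
  assumes "prime p" "\<not> [:p:] dvd q"
  shows "card {x \<in> {0..<p}. p dvd poly q x} \<le> degree q"
  using assms(2)
proof (induction "degree q" arbitrary: q rule: less_induct)
  case less
  let ?R = "\<lambda>q. {x \<in> {0..<p}. p dvd poly q x}"
  show ?case
  proof (cases "?R q = {}")
    case False
    then obtain c where c: "c \<in> {0..<p}" "p dvd poly q c" by auto
    let ?r = "synthetic_div q c"
    have q: "q = [:-c, 1:] * ?r + [:poly q c:]"
      by (rule synthetic_div_correct'[symmetric])
    have "[:p:] dvd [:poly q c:]" using c(2) by (simp add: const_poly_dvd_const_poly_iff)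
    with less.prems q have r: "\<not> [:p:] dvd ?r"
      by (metis dvd_add dvd_mult)
    have "degree q \<noteq> 0"
    proof
      assume "degree q = 0"
      then obtain a where "q = [:a:]" by (rule degree_eq_zeroE)
      with less.prems c(2) show False by (simp add: const_poly_dvd_const_poly_iff)
    qed
    then have deg: "degree ?r < degree q" by (simp add: degree_synthetic_div)
    have "?R q \<subseteq> insert c (?R ?r)"
    proof
      fix x assume x: "x \<in> ?R q"
      have "poly q x = (x - c) * poly ?r x + poly q c"
        using arg_cong[OF q, of "\<lambda>s. poly s x"] by (simp add: algebra_simps)
      with x c(2) have "p dvd (x - c) * poly ?r x"
        by (simp add: dvd_add_left_iff)
      then have "p dvd x - c \<or> p dvd poly ?r x"
        using assms(1) by (simp add: prime_dvd_mult_iff)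
      moreover have "x = c" if "p dvd x - c"
        using that x c(1) by (metis (no_types, lifting) atLeastLessThan_iff mem_Collect_eq
            mod_eq_dvd_iff mod_pos_pos_trivial)
      ultimately show "x \<in> insert c (?R ?r)" using x by auto
    qed
    then have "card (?R q) \<le> card (insert c (?R ?r))"
      by (intro card_mono finite.insertI finite_subset[of "?R ?r" "{0..<p}"]) auto
    also have "\<dots> \<le> Suc (card (?R ?r))" by (rule card_insert_le_m1[THEN le_trans]) auto
    also have "\<dots> \<le> degree q" using less.hyps[OF deg r] deg by simp
    finally show ?thesis .
  next
    case True
    then show ?thesis by (metis card.empty le0)
  qed
qed

text \<open>The root bound applies to the difference of the two polynomials, which is nonzero modulo
  \<open>p\<close> because distinct numbers below \<open>p\<close> are incongruent.\<close>

lemma card_poly_agreement_mod_prime: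
  fixes a b :: "nat \<Rightarrow> nat"
  assumes p: "prime p" and ab: "\<And>i. i < d \<Longrightarrow> a i < p \<and> b i < p" and "\<exists>i<d. a i \<noteq> b i"
  shows "card {x \<in> {..<p}. (\<Sum>i<d. a i * x ^ i) mod p = (\<Sum>i<d. b i * x ^ i) mod p} \<le> d"
proof -
  define q where "q = (\<Sum>i<d. monom (int (a i) - int (b i)) i)"
  have coeff: "coeff q i = (if i < d then int (a i) - int (b i) else 0)" for i
    by (simp add: q_def coeff_sum if_distrib cong: if_cong)
  have "degree q \<le> d" by (rule degree_le) (simp add: coeff)
  have eval: "poly q x = (\<Sum>i<d. int (a i) * x ^ i) - (\<Sum>i<d. int (b i) * x ^ i)" for x
    by (simp add: q_def poly_sum poly_monom algebra_simps sum_subtractf)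
  have "\<not> [:int p:] dvd q"
  proof
    assume *: "[:int p:] dvd q"
    from assms(3) obtain i where i: "i < d" "a i \<noteq> b i" by blast
    from * have "int p dvd int (a i) - int (b i)"
      using i by (metis coeff const_poly_dvd_iff)
    then have "int (a i) mod int p = int (b i) mod int p" by (simp add: mod_eq_dvd_iff)
    with ab[OF i(1)] i(2) show False by simp
  qed
  then have le: "card {x \<in> {0..<int p}. int p dvd poly q x} \<le> degree q"
    using p by (intro card_roots_mod_prime_le_degree) auto
  let ?S = "{x \<in> {..<p}. (\<Sum>i<d. a i * x ^ i) mod p = (\<Sum>i<d. b i * x ^ i) mod p}"
  have "int ` ?S \<subseteq> {x \<in> {0..<int p}. int p dvd poly q x}"
  proof
    fix y assume "y \<in> int ` ?S"
    then obtain x where x: "y = int x" "x < p"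
      "(\<Sum>i<d. a i * x ^ i) mod p = (\<Sum>i<d. b i * x ^ i) mod p" by auto
    then have "int (\<Sum>i<d. a i * x ^ i) mod int p = int (\<Sum>i<d. b i * x ^ i) mod int p"
      by (metis zmod_int)
    then show "y \<in> {x \<in> {0..<int p}. int p dvd poly q x}"
      using x by (simp add: eval mod_eq_dvd_iff)
  qed
  then have "card (int ` ?S) \<le> card {x \<in> {0..<int p}. int p dvd poly q x}"
    by (intro card_mono finite_subset[of "{x \<in> {0..<int p}. int p dvd poly q x}" "{0..<int p}"]) auto
  with le \<open>degree q \<le> d\<close> show ?thesis by (simp add: card_image)
qed

section \<open>The tree of digit strings\<close>

text \<open>\<open>dg x\<close> is the path from the root of the tree to the leaf \<open>x\<close>.
  Any injective coding will do, positional or not.\<close>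

definition digits :: "nat \<Rightarrow> nat \<Rightarrow> nat \<Rightarrow> (nat \<Rightarrow> nat \<Rightarrow> nat) \<Rightarrow> bool" where
  "digits n d p dg \<longleftrightarrow> (\<forall>x<n. \<forall>i<d. dg x i < p) \<and> (\<forall>x<n. \<forall>y<n. x \<noteq> y \<longrightarrow> (\<exists>i<d. dg x i \<noteq> dg y i))"

lemma digits_exist: "\<exists>dg. digits (p ^ d) d p dg"
proof -
  have "card (PiE {..<d} (\<lambda>_. {..<p})) = p ^ d" by (simp add: card_PiE)
  then obtain dg where dg: "bij_betw dg {..<p ^ d} (PiE {..<d} (\<lambda>_. {..<p}))"
    using finite_same_card_bij[of "{..<p ^ d}" "PiE {..<d} (\<lambda>_. {..<p})"]
    by (auto simp: finite_PiE)
  have *: "dg x \<in> PiE {..<d} (\<lambda>_. {..<p})" if "x < p ^ d" for x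
    using bij_betwE[OF dg] that by auto
  have "\<exists>i<d. dg x i \<noteq> dg y i" if "x < p ^ d" "y < p ^ d" "x \<noteq> y" for x y
    using PiE_ext[OF *[OF that(1)] *[OF that(2)]] that bij_betw_imp_inj_on[OF dg]
    by (auto simp: inj_on_def)
  with * have "digits (p ^ d) d p dg" by (auto simp: digits_def PiE_iff)
  then show ?thesis by blast
qed

text \<open>The depth at which the paths to \<open>x\<close> and \<open>y\<close> separate; a larger
  value means closer leaves. For \<open>x = y\<close> the value is unspecified.\<close>

definition first_diff :: "(nat \<Rightarrow> nat \<Rightarrow> nat) \<Rightarrow> nat \<Rightarrow> nat \<Rightarrow> nat" where
  "first_diff dg x y = (LEAST i. dg x i \<noteq> dg y i)"

lemma first_diff_commute: "first_diff dg x y = first_diff dg y x"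
  by (simp add: first_diff_def eq_commute)

lemma first_diff:
  assumes "digits n d p dg" "x < n" "y < n" "x \<noteq> y"
  shows "first_diff dg x y < d" "dg x (first_diff dg x y) \<noteq> dg y (first_diff dg x y)"
    "\<And>i. i < first_diff dg x y \<Longrightarrow> dg x i = dg y i"
proof -
  obtain i where i: "i < d" "dg x i \<noteq> dg y i" using assms unfolding digits_def by blast
  show "first_diff dg x y < d"
    unfolding first_diff_def using Least_le[of "\<lambda>i. dg x i \<noteq> dg y i", OF i(2)] i(1) by simp
  show "dg x (first_diff dg x y) \<noteq> dg y (first_diff dg x y)"
    unfolding first_diff_def by (rule LeastI[of "\<lambda>i. dg x i \<noteq> dg y i", OF i(2)])
  show "\<And>i. i < first_diff dg x y \<Longrightarrow> dg x i = dg y i"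
    unfolding first_diff_def using not_less_Least by blast
qed

text \<open>Two paths that both follow the path to \<open>y\<close> down to some depth agree down to
  there. As large values mean closeness, the strong triangle inequality appears with its order
  reversed.\<close>

lemma first_diff_ultrametric:
  assumes "digits n d p dg" "x < n" "y < n" "z < n" "x \<noteq> y" "y \<noteq> z" "x \<noteq> z"
  shows "first_diff dg x y \<le> first_diff dg x z \<or> first_diff dg y z \<le> first_diff dg x z"
proof (rule ccontr)
  assume "\<not> ?thesis"
  then have "dg x (first_diff dg x z) = dg z (first_diff dg x z)"
    using first_diff(3)[OF assms(1-3,5), of "first_diff dg x z"]
      first_diff(3)[OF assms(1,3,4,6), of "first_diff dg x z"]
    by simp
  with first_diff(2)[OF assms(1,2,4,7)] show False by simp
qed

text \<open>Names the subtree containing \<open>x\<close> among those hanging off the path to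
  \<open>u\<close>: the depth at which it is attached and the child chosen there.\<close>

definition branch :: "(nat \<Rightarrow> nat \<Rightarrow> nat) \<Rightarrow> nat \<Rightarrow> nat \<Rightarrow> nat \<times> nat" where
  "branch dg u x = (first_diff dg u x, dg x (first_diff dg u x))"

text \<open>Two leaves share a subtree hanging off the path to \<open>u\<close> exactly if their
  paths separate only after leaving that path.\<close>

lemma branch_eq_iff:
  assumes "digits n d p dg" "u < n" "x < n" "y < n" "u \<noteq> x" "u \<noteq> y" "x \<noteq> y"
  shows "branch dg u x = branch dg u y \<longleftrightarrow> first_diff dg u x < first_diff dg x y"
proof
  assume *: "branch dg u x = branch dg u y"
  show "first_diff dg u x < first_diff dg x y"
  proof (rule ccontr)
    assume "\<not> ?thesis"
    then consider "first_diff dg x y = first_diff dg u x" | "first_diff dg x y < first_diff dg u x" by linarith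
    then show False
    proof cases
      case 1
      with * first_diff(2)[OF assms(1,3,4,7)] show False by (auto simp: branch_def)
    next
      case 2
      with * have "dg u (first_diff dg x y) = dg x (first_diff dg x y)" "dg u (first_diff dg x y) = dg y (first_diff dg x y)"
        using first_diff(3)[OF assms(1,2,3,5)] first_diff(3)[OF assms(1,2,4,6)]
          by (auto simp: branch_def)
      with first_diff(2)[OF assms(1,3,4,7)] show False by simp
    qed
  qed
next
  assume *: "first_diff dg u x < first_diff dg x y"
  then have "dg x (first_diff dg u x) = dg y (first_diff dg u x)"
    using first_diff(3)[OF assms(1,3,4,7)] by simp
  moreover have "first_diff dg u x = first_diff dg u y"
    using * first_diff_ultrametric[OF assms(1), of u x y]
      first_diff_ultrametric[OF assms(1), of u y x]
      first_diff_ultrametric[OF assms(1), of x u y] assms first_diff_commute[of dg]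
    by (metis leD linorder_cases order_less_le_trans)
  ultimately show "branch dg u x = branch dg u y" by (simp add: branch_def)
qed

definition pair_separating :: "nat \<Rightarrow> (nat \<Rightarrow> nat \<Rightarrow> nat \<Rightarrow> 'c) \<Rightarrow> bool" where
  "pair_separating n h \<longleftrightarrow> (\<forall>x<n. \<forall>y<n. \<forall>z<n. \<forall>w<n. x \<noteq> y \<longrightarrow> z \<noteq> w \<longrightarrow>
     h x y z \<noteq> h x y w \<or> h z w x \<noteq> h z w y)"

lemma pair_separatingD:
  "\<lbrakk>pair_separating n h; x < n; y < n; z < n; w < n; x \<noteq> y; z \<noteq> w\<rbrakk> \<Longrightarrow>
     h x y z \<noteq> h x y w \<or> h z w x \<noteq> h z w y"
  unfolding pair_separating_def by blast

text \<open>The first component evaluates \<open>z\<close>, read as a polynomial over the integers modulo \<open>p\<close>, at the sum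
  of the first digits in which \<open>x\<close> and \<open>y\<close> differ. If it does not separate \<open>z\<close> from \<open>w\<close>, that sum is
  one of at most \<open>d\<close> common values of two polynomials. For each of these and each \<open>i\<close>, the digits \<open>a, b\<close>
  at position \<open>i\<close> with that sum form a matching, so a bit recording which one is smaller tells \<open>x\<close>
  from \<open>y\<close>.\<close>

lemma pair_hash:
  assumes dg: "digits n d p dg" and p: "prime p"
  shows "\<exists>h :: nat \<Rightarrow> nat \<Rightarrow> nat \<Rightarrow> nat \<times> (nat \<times> nat) set.
    (\<forall>x y z. h x y z \<in> {..<p} \<times> Pow ({..<d} \<times> {..<d})) \<and>
    pair_separating n h"
proof -
  define P where "P z x = (\<Sum>i<d. dg z i * x ^ i) mod p" for z x
  define s where "s x y = (dg x (first_diff dg x y) + dg y (first_diff dg x y)) mod p" for x y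
  define R where "R z w = {x \<in> {..<p}. P z x = P w x}" for z w
  have p0: "p > 0" using p by (simp add: prime_gt_0_nat)
  have "\<exists>en. inj_on en (R z w) \<and> en ` R z w \<subseteq> {..<d}" if "z < n" "w < n" "z \<noteq> w" for z w
  proof -
    have "card (R z w) \<le> d"
      unfolding R_def P_def using dg that by (intro card_poly_agreement_mod_prime p) (auto simp: digits_def)
    moreover have "finite (R z w)" by (simp add: R_def)
    ultimately show ?thesis
      using card_le_inj[of "R z w" "{..<d}"] by auto
  qed
  then obtain en where en: "\<And>z w. z < n \<Longrightarrow> w < n \<Longrightarrow> z \<noteq> w \<Longrightarrow>
      inj_on (en z w) (R z w) \<and> en z w ` R z w \<subseteq> {..<d}"
    by metis
  \<comment> \<open>\<open>(a + p - dg x i) mod p\<close> is the digit whose sum with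
    \<open>dg x i\<close> is \<open>a\<close> modulo \<open>p\<close>. The intersection keeps the
    values in range also where \<open>en\<close> is unspecified.\<close>
  define kap where "kap z w x = {(i, en z w a) | i a. i < d \<and> a \<in> R z w \<and> dg x i < (a + p - dg x i) mod p}
      \<inter> {..<d} \<times> {..<d}" for z w x
  \<comment> \<open>The two components serve opposite roles: the pair \<open>x y\<close> reads
    \<open>z\<close> through \<open>P\<close>, while the pair \<open>z w\<close> reads
    \<open>x\<close> through \<open>kap\<close>.\<close>
  define h where "h x y z = (P z (s x y), kap x y z)" for x y z
  have "h x y z \<in> {..<p} \<times> Pow ({..<d} \<times> {..<d})" for x y z
    using p0 by (auto simp: h_def P_def kap_def)
  moreover have "kap z w x \<noteq> kap z w y"
    if xyzw: "x < n" "y < n" "z < n" "w < n" "x \<noteq> y" "z \<noteq> w" and P: "P z (s x y) = P w (s x y)" for x y z w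
  proof -
    let ?i = "first_diff dg x y" and ?a = "s x y"
    have i: "?i < d" "dg x ?i \<noteq> dg y ?i" using first_diff[OF dg] xyzw by auto
    then have lt: "dg x ?i < p" "dg y ?i < p" using dg xyzw by (auto simp: digits_def)
    have a: "?a \<in> R z w" using P p0 by (simp add: R_def s_def)
    \<comment> \<open>For the sum \<open>?a\<close> the digits of \<open>x\<close> and
      \<open>y\<close> are each other's partner, so exactly one of the two comparisons in
      \<open>kap\<close> holds.\<close>
    have inv: "(?a + p - dg x ?i) mod p = dg y ?i" "(?a + p - dg y ?i) mod p = dg x ?i"
      using lt unfolding s_def by (auto simp: mod_if)
    have mem: "(?i, en z w ?a) \<in> kap z w v \<longleftrightarrow> dg v ?i < (?a + p - dg v ?i) mod p" for v
      using en[OF xyzw(3,4,6)] a i(1) by (auto simp: kap_def inj_on_def)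
    show ?thesis
    proof
      assume "kap z w x = kap z w y"
      with mem[of x] mem[of y] inv i(2) show False by auto
    qed
  qed
  ultimately show ?thesis by (intro exI[of _ h]) (auto simp: h_def pair_separating_def)
qed

section \<open>The colouring of each vertex and its rainbow copies\<close>

text \<open>The sum type keeps the edges at \<open>u\<close> apart from all others. The image over
  \<open>e\<close> makes the colour symmetric in the two ends, yet ties each value of
  \<open>h\<close> to the branch of its own end.\<close>

definition vertex_colouring :: "(nat \<Rightarrow> nat \<Rightarrow> nat) \<Rightarrow> (nat \<Rightarrow> nat \<Rightarrow> nat \<Rightarrow> 'c) \<Rightarrow> nat \<Rightarrow> nat set \<Rightarrow>
    (nat \<times> nat) + ((nat \<times> nat) \<times> 'c) set" where
  "vertex_colouring dg h u e = (if u \<in> e then Inl (branch dg u (the_elem (e - {u})))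
     else Inr ((\<lambda>x. (branch dg u x, h u x (the_elem (e - {x})))) ` e))"

lemma vertex_colouring_star:
  assumes "u \<noteq> x"
  shows "vertex_colouring dg h u {u, x} = Inl (branch dg u x)" "vertex_colouring dg h u {x, u} = Inl (branch dg u x)"
proof -
  have "{u, x} - {u} = {x}" using assms by auto
  then show "vertex_colouring dg h u {u, x} = Inl (branch dg u x)" by (simp add: vertex_colouring_def)
  then show "vertex_colouring dg h u {x, u} = Inl (branch dg u x)" by (simp add: insert_commute)
qed

lemma vertex_colouring_pair:
  assumes "u \<noteq> x" "u \<noteq> y" "x \<noteq> y"
  shows "vertex_colouring dg h u {x, y} = Inr {(branch dg u x, h u x y), (branch dg u y, h u y x)}"
proof -
  have "{x, y} - {x} = {y}" "{x, y} - {y} = {x}" using assms by auto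
  then show ?thesis using assms by (simp add: vertex_colouring_def)
qed

text \<open>Integer-valued, since \<open>smt\<close> handles the case distinctions on distances below over the integers
  but not over the naturals.\<close>

definition level :: "(nat \<Rightarrow> nat \<Rightarrow> nat) \<Rightarrow> nat \<Rightarrow> nat \<Rightarrow> int" where
  "level dg x y = int (first_diff dg x y)"

lemma level_commute: "level dg x y = level dg y x"
  by (simp add: level_def first_diff_commute)

context
  fixes n k p :: nat and dg :: "nat \<Rightarrow> nat \<Rightarrow> nat" and h :: "nat \<Rightarrow> nat \<Rightarrow> nat \<Rightarrow> 'c"
  assumes dg: "digits n k p dg"
begin

abbreviation D where "D \<equiv> level dg"
abbreviation col where "col \<equiv> vertex_colouring dg h"
abbreviation br where "br \<equiv> branch dg"

lemma ultrametric:
  assumes "x < n" "y < n" "z < n" "x \<noteq> y" "y \<noteq> z" "x \<noteq> z"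
  shows "(D x y \<le> D x z \<or> D y z \<le> D x z) \<and> (D x y \<le> D y z \<or> D x z \<le> D y z) \<and>
    (D x z \<le> D x y \<or> D y z \<le> D x y)"
  using first_diff_ultrametric[OF dg, of x y z] first_diff_ultrametric[OF dg, of y x z]
    first_diff_ultrametric[OF dg, of x z y] assms by (auto simp: level_def first_diff_commute)

lemma branch_eq:
  assumes "u < n" "x < n" "y < n" "u \<noteq> x" "u \<noteq> y" "x \<noteq> y"
  shows "br u x = br u y \<longleftrightarrow> D u x < D x y"
  using branch_eq_iff[OF dg assms] by (simp add: level_def)

text \<open>Only the two edges at the chosen vertex can collide. At a vertex of a closest pair they
  do not: its partner and the third vertex lie in different branches.\<close>

lemma rainbow_triangle:
  assumes "distinct [a, b, c]" "a < n" "b < n" "c < n"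
  shows "\<exists>u\<in>{a, b, c}. inj_on (col u) {{a, b}, {b, c}, {c, a}}"
proof -
  have "br a b \<noteq> br a c \<or> br b a \<noteq> br b c \<or> br c a \<noteq> br c b"
    using ultrametric[of a b c] branch_eq[of a b c] branch_eq[of b a c] branch_eq[of c a b] assms
    by (auto simp: level_commute)
  then show ?thesis
    using assms(1) by (elim disjE) (auto simp: inj_on_def vertex_colouring_star vertex_colouring_pair)
qed

text \<open>Let \<open>a b\<close> be a closest pair of the triangle. If \<open>a\<close> confuses
  \<open>{b, c}\<close> with \<open>{x, y}\<close>, then one of \<open>x, y\<close> is closer to
  \<open>b\<close> than \<open>a\<close> is and the other lies in the branch of \<open>c\<close> at
  \<open>a\<close>. Neither is then in the branch of \<open>a\<close> at \<open>b\<close>, so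
  \<open>b\<close> works. Comparing branches alone turns this into inequalities between
  levels.\<close>

lemma rainbow_triangle_edge:
  assumes ne: "distinct [a, b, c, x, y]" and lt: "a < n" "b < n" "c < n" "x < n" "y < n"
  shows "\<exists>u\<in>{a, b, c}. inj_on (col u) {{a, b}, {b, c}, {c, a}, {x, y}}"
proof (rule ccontr)
  assume neg: "\<not> ?thesis"
  have "br a b = br a c \<or> {br a b, br a c} = {br a x, br a y}"
  proof (rule ccontr)
    assume "\<not> ?thesis"
    then have "inj_on (col a) {{a, b}, {b, c}, {c, a}, {x, y}}"
      using ne by (auto simp: inj_on_def vertex_colouring_star vertex_colouring_pair doubleton_eq_iff)
    with neg show False by simp
  qed
  moreover have "br b a = br b c \<or> {br b a, br b c} = {br b x, br b y}"
  proof (rule ccontr)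
    assume "\<not> ?thesis"
    then have "inj_on (col b) {{a, b}, {b, c}, {c, a}, {x, y}}"
      using ne by (auto simp: inj_on_def vertex_colouring_star vertex_colouring_pair doubleton_eq_iff)
    with neg show False by simp
  qed
  moreover have "br c a = br c b \<or> {br c a, br c b} = {br c x, br c y}"
  proof (rule ccontr)
    assume "\<not> ?thesis"
    then have "inj_on (col c) {{a, b}, {b, c}, {c, a}, {x, y}}"
      using ne by (auto simp: inj_on_def vertex_colouring_star vertex_colouring_pair doubleton_eq_iff)
    with neg show False by simp
  qed
  ultimately have
    "D a b < D b c \<or> D a b < D b x \<and> D a c < D c y \<or> D a b < D b y \<and> D a c < D c x"
    "D a b < D a c \<or> D a b < D a x \<and> D b c < D c y \<or> D a b < D a y \<and> D b c < D c x"
    "D a c < D a b \<or> D a c < D a x \<and> D b c < D b y \<or> D a c < D a y \<and> D b c < D b x"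
    using ne lt by (auto simp: doubleton_eq_iff branch_eq level_commute)
  then show False
    using ultrametric[of a b c] ultrametric[of a b x] ultrametric[of a b y] ultrametric[of a c x]
      ultrametric[of a c y] ultrametric[of a x y]
      ultrametric[of b c x] ultrametric[of b c y] ultrametric[of b x y] ultrametric[of c x y] ne lt
    by (simp, smt (z3))
qed

text \<open>If a closest pair consists of \<open>u\<close> and a vertex \<open>v\<close> of another
  edge, then \<open>v\<close> is alone in its branch at \<open>u\<close>, so \<open>u\<close> works.
  Otherwise a closest pair is an edge, say \<open>{a, b}\<close>, and it lies in one branch at
  \<open>c\<close> and at \<open>e\<close>. Then \<open>c\<close> fails only if \<open>e\<close> is
  closer to \<open>a\<close> than \<open>c\<close> is, and \<open>e\<close> fails only if the
  converse holds.\<close>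

lemma rainbow_matching:
  assumes ne: "distinct [a, b, c, d, e, f]" and lt: "a < n" "b < n" "c < n" "d < n" "e < n" "f < n"
  shows "\<exists>u\<in>{a, b, c, d, e, f}. inj_on (col u) {{a, b}, {c, d}, {e, f}}"
proof (rule ccontr)
  assume neg: "\<not> ?thesis"
  have bad: "br u v = br u x \<and> br u w = br u y \<or> br u v = br u y \<and> br u w = br u x"
    if "{{u, u'}, {v, w}, {x, y}} = {{a, b}, {c, d}, {e, f}}" "u \<in> {a, b, c, d, e, f}"
      "distinct [u, u', v, w, x, y]" for u u' v w x y
  proof (rule ccontr)
    assume "\<not> ?thesis"
    then have "inj_on (col u) {{u, u'}, {v, w}, {x, y}}"
      using that(3) by (auto simp: inj_on_def vertex_colouring_star vertex_colouring_pair doubleton_eq_iff)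
    with neg that(1,2) show False by metis
  qed
  have "D a c < D c e \<and> D a d < D d f \<or> D a c < D c f \<and> D a d < D d e"
    using bad[of a b c d e f] ne lt by (auto simp: branch_eq)
  moreover have "D b c < D c e \<and> D b d < D d f \<or> D b c < D c f \<and> D b d < D d e"
    using bad[of b a c d e f] ne lt by (auto simp: branch_eq insert_commute)
  moreover have "D a c < D a e \<and> D b c < D b f \<or> D a c < D a f \<and> D b c < D b e"
    using bad[of c d a b e f] ne lt by (auto simp: branch_eq insert_commute level_commute)
  moreover have "D a d < D a e \<and> D b d < D b f \<or> D a d < D a f \<and> D b d < D b e"
    using bad[of d c a b e f] ne lt by (auto simp: branch_eq insert_commute level_commute)
  moreover have "D a e < D a c \<and> D b e < D b d \<or> D a e < D a d \<and> D b e < D b c"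
    using bad[of e f a b c d] ne lt by (auto simp: branch_eq insert_commute level_commute)
  moreover have "D a f < D a c \<and> D b f < D b d \<or> D a f < D a d \<and> D b f < D b c"
    using bad[of f e a b c d] ne lt by (auto simp: branch_eq insert_commute level_commute)
  ultimately show False
    using ultrametric[of a b c] ultrametric[of a b d] ultrametric[of a b e] ultrametric[of a b f]
      ultrametric[of a c d] ultrametric[of a c e]
      ultrametric[of a c f] ultrametric[of a d e] ultrametric[of a d f] ultrametric[of a e f]
      ultrametric[of b c d] ultrametric[of b c e]
      ultrametric[of b c f] ultrametric[of b d e] ultrametric[of b d f] ultrametric[of b e f]
      ultrametric[of c d e] ultrametric[of c d f]
      ultrametric[of c e f] ultrametric[of d e f] ne lt
    by (simp, smt (z3))
qed

text \<open>A vertex that sees the other three in different branches works. If there is none, the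
  vertices split into two close pairs, and only here can branches fail to decide; then the
  separation of pairs by pairs does.\<close>

lemma rainbow_paw:
  assumes ne: "distinct [a, b, c, d]" and lt: "a < n" "b < n" "c < n" "d < n"
    and h: "pair_separating n h"
  shows "\<exists>u\<in>{a, b, c, d}. inj_on (col u) {{a, b}, {b, c}, {c, a}, {c, d}}"
proof (rule ccontr)
  assume neg: "\<not> ?thesis"
  have "br a b = br a c \<or> br a b = br a d \<or> br a c = br a d"
  proof (rule ccontr)
    assume "\<not> ?thesis"
    then have "inj_on (col a) {{a, b}, {b, c}, {c, a}, {c, d}}"
      using ne by (auto simp: inj_on_def vertex_colouring_star vertex_colouring_pair doubleton_eq_iff)
    with neg show False by simp
  qed
  moreover have "br b a = br b c \<or> br b a = br b d \<or> br b c = br b d"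
  proof (rule ccontr)
    assume "\<not> ?thesis"
    then have "inj_on (col b) {{a, b}, {b, c}, {c, a}, {c, d}}"
      using ne by (auto simp: inj_on_def vertex_colouring_star vertex_colouring_pair doubleton_eq_iff)
    with neg show False by simp
  qed
  moreover have "br c a = br c b \<or> br c a = br c d \<or> br c b = br c d"
  proof (rule ccontr)
    assume "\<not> ?thesis"
    then have "inj_on (col c) {{a, b}, {b, c}, {c, a}, {c, d}}"
      using ne by (auto simp: inj_on_def vertex_colouring_star vertex_colouring_pair doubleton_eq_iff)
    with neg show False by simp
  qed
  moreover have "br d a = br d b \<or> br d a = br d c \<or> br d b = br d c"
  proof (rule ccontr)
    assume "\<not> ?thesis"
    then have "inj_on (col d) {{a, b}, {b, c}, {c, a}, {c, d}}"
      using ne by (auto simp: inj_on_def vertex_colouring_star vertex_colouring_pair doubleton_eq_iff)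
    with neg show False by simp
  qed
  ultimately have
    "D a b < D b c \<or> D a b < D b d \<or> D a c < D c d" "D a b < D a c \<or> D a b < D a d \<or> D b c < D c d"
    "D a c < D a b \<or> D a c < D a d \<or> D b c < D b d" "D a d < D a b \<or> D a d < D a c \<or> D b d < D b c"
    using ne lt by (auto simp: branch_eq level_commute)
  \<comment> \<open>The possible splittings into two close pairs, named after the pair that contains
    \<open>c\<close>.\<close>
  then consider
      (cd) "D a c < D a b" "D a c < D c d" "D a c = D a d" "D a c = D b c" "D a c = D b d"
    | (ca) "D a b < D a c" "D a b < D b d" "D a b = D a d" "D a b = D b c" "D a b = D c d"
    | (cb) "D a b < D a d" "D a b < D b c" "D a b = D a c" "D a b = D b d" "D a b = D c d"
    using ultrametric[of a b c] ultrametric[of a b d] ultrametric[of a c d] ultrametric[of b c d]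
      ne lt
    by (simp, smt (z3))
  then show False
  proof cases
    case cd
    then have "br a b \<noteq> br a c" "br a d = br a c"
      using ne lt branch_eq[of a b c] branch_eq[of a c d] by auto
    \<comment> \<open>Seen from \<open>a\<close>, the edge \<open>{c, d}\<close> stays in one branch
      while \<open>{b, c}\<close> spans two.\<close>
    then have "inj_on (col a) {{a, b}, {b, c}, {c, a}, {c, d}}"
      using ne by (auto simp: inj_on_def vertex_colouring_star vertex_colouring_pair doubleton_eq_iff)
    with neg show False by simp
  next
    case ca
    then have br: "br a b \<noteq> br a c" "br a d = br a b" "br d b \<noteq> br d c" "br d a = br d c"
      using ne lt branch_eq[of a b c] branch_eq[of a b d] branch_eq[of d b c] branch_eq[of d a c]
      by (auto simp: level_commute)
    \<comment> \<open>The close pairs are \<open>a c\<close> and \<open>b d\<close>. Either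
      \<open>a\<close> tells \<open>{b, c}\<close> from \<open>{c, d}\<close> by the value attached
      to the branch of \<open>c\<close>, or \<open>d\<close> tells \<open>{a, b}\<close> from
      \<open>{b, c}\<close> by the one attached to the branch of \<open>b\<close>.\<close>
    from pair_separatingD[OF h, of a c d b] ne lt consider "h a c b \<noteq> h a c d" | "h d b a \<noteq> h d b c" by auto
    then show False
    proof cases
      case 1
      then have "inj_on (col a) {{a, b}, {b, c}, {c, a}, {c, d}}"
        using ne br by (auto simp: inj_on_def vertex_colouring_star vertex_colouring_pair doubleton_eq_iff)
      with neg show False by simp
    next
      case 2
      then have "inj_on (col d) {{a, b}, {b, c}, {c, a}, {c, d}}"
        using ne br by (auto simp: inj_on_def vertex_colouring_star vertex_colouring_pair doubleton_eq_iff)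
      with neg show False by simp
    qed
  next
    case cb
    then have br: "br b a \<noteq> br b c" "br b d = br b a" "br d a \<noteq> br d c" "br d b = br d c"
      using ne lt branch_eq[of b a c] branch_eq[of b a d] branch_eq[of d a c] branch_eq[of d b c]
      by (auto simp: level_commute)
    from pair_separatingD[OF h, of b c d a] ne lt consider "h b c a \<noteq> h b c d" | "h d a b \<noteq> h d a c" by auto
    then show False
    proof cases
      case 1
      then have "inj_on (col b) {{a, b}, {b, c}, {c, a}, {c, d}}"
        using ne br by (auto simp: inj_on_def vertex_colouring_star vertex_colouring_pair doubleton_eq_iff)
      with neg show False by simp
    next
      case 2
      then have "inj_on (col d) {{a, b}, {b, c}, {c, a}, {c, d}}"
        using ne br by (auto simp: inj_on_def vertex_colouring_star vertex_colouring_pair doubleton_eq_iff)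
      with neg show False by simp
    qed
  qed
qed

end

section \<open>Graphs with few edges, and twins in graphs with many edges\<close>

lemma nsets_3_2: "nsets {..<3::nat} 2 = {{0, 1}, {1, 2}, {2, 0}}"
proof
  show "nsets {..<3::nat} 2 \<subseteq> {{0, 1}, {1, 2}, {2, 0}}"
  proof
    fix e :: "nat set" assume "e \<in> nsets {..<3} 2"
    then obtain x y where e: "e = {x, y}" "x \<noteq> y" "x < 3" "y < 3"
      by (auto simp: nsets_2_eq)
    then have "x \<in> {0, 1, 2}" "y \<in> {0, 1, 2}" by auto
    with e show "e \<in> {{0, 1}, {1, 2}, {2, 0}}" by (auto simp: insert_commute)
  qed
qed (auto simp: nsets_def)

definition triangle :: "'a set set \<Rightarrow> 'a \<Rightarrow> 'a \<Rightarrow> 'a \<Rightarrow> bool" where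
  "triangle E a b c \<longleftrightarrow> distinct [a, b, c] \<and> {{a, b}, {b, c}, {c, a}} \<subseteq> E"

lemma triangle_free_iff:
  assumes "sgraph G"
  shows "triangle_free G \<longleftrightarrow> (\<nexists>a b c. triangle (edges G) a b c)"
proof -
  have "\<exists>T. copy_in (complete_graph 3) G T" if abc: "triangle (edges G) a b c" for a b c
  proof -
    let ?\<phi> = "\<lambda>i::nat. if i = 0 then a else if i = 1 then b else c"
    have three: "{..<3::nat} = {0, 1, 2}" by auto
    have "graph_iso (complete_graph 3) (Graph {a, b, c} {{a, b}, {b, c}, {c, a}})"
      unfolding graph_iso_def complete_graph_def graph.sel nsets_3_2
    proof (intro exI[of _ ?\<phi>] conjI)
      show "bij_betw ?\<phi> {..<3} {a, b, c}"
        unfolding three bij_betw_def using abc by (auto simp: inj_on_def triangle_def)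
      show "(`) ?\<phi> ` {{0, 1}, {1, 2}, {2, 0}} = {{a, b}, {b, c}, {c, a}}" by (auto simp: insert_commute)
    qed
    moreover have "{a, b} \<in> nsets (verts G) 2" "{b, c} \<in> nsets (verts G) 2"
      using abc assms by (auto simp: triangle_def sgraph_def)
    then have "subgraph (Graph {a, b, c} {{a, b}, {b, c}, {c, a}}) G"
      using abc by (auto simp: subgraph_def nsets_def triangle_def)
    ultimately show ?thesis by (auto simp: copy_in_def)
  qed
  moreover have "\<exists>a b c. triangle (edges G) a b c" if T: "copy_in (complete_graph 3) G T" for T
  proof -
    have "graph_iso (complete_graph 3) T" using T by (simp add: copy_in_def)
    then obtain \<phi> where \<phi>: "bij_betw \<phi> {..<3::nat} (verts T)" "(`) \<phi> ` {{0, 1}, {1, 2}, {2, 0}} = edges T"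
      by (auto simp: graph_iso_def complete_graph_def nsets_3_2)
    have "edges T \<subseteq> edges G" using T by (simp add: copy_in_def subgraph_def)
    then have "{{\<phi> 0, \<phi> 1}, {\<phi> 1, \<phi> 2}, {\<phi> 2, \<phi> 0}} \<subseteq> edges G" unfolding \<phi>(2)[symmetric] by simp
    moreover have "distinct [\<phi> 0, \<phi> 1, \<phi> 2]"
      using bij_betw_imp_inj_on[OF \<phi>(1)] by (auto simp: inj_on_eq_iff)
    ultimately show ?thesis unfolding triangle_def by blast
  qed
  ultimately show ?thesis unfolding triangle_free_def by blast
qed

text \<open>Recognises the one shape in \<open>polynomial_configurations\<close> for which none of
  the three configurations is produced: the path \<open>b, c, a, x\<close> and the edge
  \<open>{p, q}\<close>.\<close>

lemma path3_path1_iso: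
  assumes H: "sgraph H" and ne: "distinct [a, b, c, x, p, q]"
    and E: "edges H = {{b, c}, {c, a}, {a, x}, {p, q}}"
  shows "\<exists>m. graph_iso H
    (disjoint_union (disjoint_union (path_graph 3) (path_graph 1)) (empty_graph m))"
proof -
  define S where "S = {b, c, a, x, p, q}"
  let ?R = "verts H - S"
  have sub: "S \<subseteq> verts H" and fin: "finite (verts H)"
    using H E by (auto simp: S_def sgraph_def nsets_def)
  then obtain r where r: "bij_betw r ?R {..<card ?R}"
    by (metis ex_bij_betw_finite_nat finite_Diff atLeast0LessThan)
  define \<phi> :: "'a \<Rightarrow> (nat + nat) + nat" where
    "\<phi> = (\<lambda>v. if v = b then Inl (Inl 0) else if v = c then Inl (Inl 1) else if v = a then Inl (Inl 2)
       else if v = x then Inl (Inl 3) else if v = p then Inl (Inr 0) else if v = q then Inl (Inr 1)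
       else Inr (r v))"
  have vals: "\<phi> b = Inl (Inl 0)" "\<phi> c = Inl (Inl 1)" "\<phi> a = Inl (Inl 2)" "\<phi> x = Inl (Inl 3)"
    "\<phi> p = Inl (Inr 0)" "\<phi> q = Inl (Inr 1)" "\<And>v. v \<in> ?R \<Longrightarrow> \<phi> v = Inr (r v)"
    using ne by (auto simp: \<phi>_def S_def)
  have upto: "{..3::nat} = {0, 1, 2, 3}" "{..1::nat} = {0, 1}" by auto
  have "\<phi> ` verts H = \<phi> ` S \<union> \<phi> ` ?R" using sub by blast
  also have "\<phi> ` ?R = Inr ` {..<card ?R}"
    using vals(7) bij_betw_imp_surj_on[OF r] by (metis (no_types, lifting) image_cong image_image)
  also have "\<phi> ` S = Inl ` ({..3} <+> {..1})" unfolding upto S_def by (auto simp: vals Plus_def)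
  finally have ran: "\<phi> ` verts H = ({..3} <+> {..1}) <+> {..<card ?R}" by (simp add: Plus_def)
  have "inj_on \<phi> (verts H)"
  proof -
    have "inj_on \<phi> S" using vals(1-6) by (auto simp: S_def inj_on_def)
    moreover have "inj_on \<phi> ?R"
      using vals(7) bij_betw_imp_inj_on[OF r] unfolding inj_on_def by (metis Inr_inject)
    moreover have "\<phi> ` S \<inter> \<phi> ` ?R = {}" using vals by (auto simp: S_def)
    then have "\<phi> ` (S - ?R) \<inter> \<phi> ` (?R - S) = {}" by blast
    ultimately have "inj_on \<phi> (S \<union> ?R)" by (simp only: inj_on_Un)
    then show ?thesis using sub by (simp add: Un_absorb1)
  qed
  with ran have "bij_betw \<phi> (verts H) (({..3} <+> {..1}) <+> {..<card ?R})" by (simp add: bij_betw_def)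
  moreover have "{{i, Suc i} |i. i < 3} = {{0, 1}, {1, 2}, {2, 3::nat}}"
  proof -
    have "{{i, Suc i} |i. i < 3} = (\<lambda>i. {i, Suc i}) ` {0, 1, 2}" by auto
    then show ?thesis by (simp add: eval_nat_numeral)
  qed
  moreover have "{{i, Suc i} |i. i < 1} = {{0, 1::nat}}" by auto
  ultimately show ?thesis
    unfolding graph_iso_def disjoint_union_def path_graph_def empty_graph_def graph.sel E
    by (intro exI[of _ "card ?R"] exI[of _ \<phi>]) (simp add: vals insert_commute)
qed

section \<open>Existence of twins\<close>

text \<open>If no two edges meet, any four edges form a matching. Otherwise take two edges meeting
  at \<open>c\<close>, with other ends \<open>a\<close> and \<open>b\<close>. If both ends have
  neighbours outside \<open>{a, b, c}\<close>, this is \<open>star\<close>; if not,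
  \<open>core\<close> confines all edges to a list of five and inspects it.\<close>

lemma polynomial_configurations:
  assumes H: "sgraph H"
    and no: "\<nexists>m. graph_iso H
      (disjoint_union (disjoint_union (path_graph 3) (path_graph 1)) (empty_graph m))"
    and E: "card (edges H) \<ge> 5 \<or> card (edges H) = 4 \<and> triangle_free H"
  obtains
    (matching) e1 e2 e3 e4 where "{e1, e2, e3, e4} \<subseteq> edges H" "e1 \<inter> e2 = {}" "e1 \<inter> e3 = {}"
      "e1 \<inter> e4 = {}" "e2 \<inter> e3 = {}" "e2 \<inter> e4 = {}" "e3 \<inter> e4 = {}"
  | (star) a b c x y where "distinct [a, b, c]" "{a, c} \<in> edges H" "{b, c} \<in> edges H"
      "x \<notin> {a, b, c}" "{a, x} \<in> edges H" "y \<notin> {a, b, c}" "{b, y} \<in> edges H"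
  | (leaves) a b c e e' where "distinct [a, b, c]" "{a, c} \<in> edges H" "{b, c} \<in> edges H"
      "e \<in> edges H" "e' \<in> edges H" "e \<noteq> e'" "e \<inter> {a, b} = {}" "e' \<inter> {a, b} = {}"
proof (rule ccontr)
  let ?E = "edges H"
  assume "\<not> thesis"
  with that have no_matching: "\<And>e1 e2 e3 e4. \<lbrakk>{e1, e2, e3, e4} \<subseteq> ?E; e1 \<inter> e2 = {}; e1 \<inter> e3 = {};
      e1 \<inter> e4 = {}; e2 \<inter> e3 = {}; e2 \<inter> e4 = {}; e3 \<inter> e4 = {}\<rbrakk> \<Longrightarrow> False"
    and no_star: "\<And>a b c x y. \<lbrakk>distinct [a, b, c]; {a, c} \<in> ?E; {b, c} \<in> ?E;
      x \<notin> {a, b, c}; {a, x} \<in> ?E; y \<notin> {a, b, c}; {b, y} \<in> ?E\<rbrakk> \<Longrightarrow> False"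
    and no_leaves: "\<And>a b c e e'. \<lbrakk>distinct [a, b, c]; {a, c} \<in> ?E; {b, c} \<in> ?E;
      e \<in> ?E; e' \<in> ?E; e \<noteq> e'; e \<inter> {a, b} = {}; e' \<inter> {a, b} = {}\<rbrakk> \<Longrightarrow> False"
    by metis+
  have fin: "finite ?E" using H by (auto simp: sgraph_def finite_imp_finite_nsets intro: finite_subset)
  have pair: "\<exists>u v. e = {u, v} \<and> u \<noteq> v" if "e \<in> ?E" for e
    using H that by (auto simp: sgraph_def nsets_2_eq)
  have four: "4 \<le> card ?E" using E by auto
  have tf: "\<not> triangle ?E a b c" if "card ?E \<le> 4" for a b c
    using E that triangle_free_iff[OF H] by auto
  have core: False if abc: "distinct [a, b, c]" "{a, c} \<in> ?E" "{b, c} \<in> ?E"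
    and b: "\<And>y. y \<notin> {a, b, c} \<Longrightarrow> {b, y} \<notin> ?E" for a b c
  proof -
    \<comment> \<open>Otherwise \<open>x\<close> and \<open>y\<close> are twins at \<open>a\<close>,
      avoided by the edges \<open>{a, c}\<close> and \<open>{b, c}\<close>.\<close>
    have noQ: "x = y" if "x \<notin> {a, b, c}" "y \<notin> {a, b, c}" "{a, x} \<in> ?E" "{a, y} \<in> ?E" for x y
      using no_leaves[of x y a "{a, c}" "{b, c}"]
        abc that by (auto simp: insert_commute doubleton_eq_iff)
    have noN: "e = e'" if "e \<in> ?E" "e' \<in> ?E" "e \<inter> {a, b} = {}" "e' \<inter> {a, b} = {}" for e e'
      using no_leaves[of a b c e e'] abc that by blast
    have touch: "e \<in> {{a, c}, {b, c}, {a, b}} \<or> (\<exists>x. x \<notin> {a, b, c} \<and> e = {a, x}) \<or> e \<inter> {a, b} = {}"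
      if "e \<in> ?E" for e
    proof -
      from pair[OF that] obtain u v where uv: "e = {u, v}" "u \<noteq> v" by blast
      show ?thesis
      proof (cases "e \<inter> {a, b} = {}")
        case False
        have "v \<in> {a, c}" if "u = b" using b[of v] \<open>e \<in> ?E\<close> uv that by auto
        moreover have "u \<in> {a, c}" if "v = b" using b[of u] \<open>e \<in> ?E\<close> uv that by (auto simp: insert_commute)
        ultimately show ?thesis using uv False by (auto simp: insert_commute doubleton_eq_iff)
      qed simp
    qed
    \<comment> \<open>Having four edges inside this list forces the triangle \<open>a b c\<close>,
      but a graph with just four edges is triangle-free here.\<close>
    have few: False if "?E \<subseteq> {{a, c}, {b, c}, {a, b}, e}" for e
    proof -
      have "card ?E \<le> card {{a, c}, {b, c}, {a, b}, e}" using that by (intro card_mono) auto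
      also have "\<dots> \<le> 4" by (auto intro!: card_insert_le_m1)
      finally have le: "card ?E \<le> 4" .
      have "{a, b} \<in> ?E"
      proof (rule ccontr)
        assume "{a, b} \<notin> ?E"
        then have "?E \<subseteq> {{a, c}, {b, c}, e}" using that by blast
        then have "card ?E \<le> card {{a, c}, {b, c}, e}" by (intro card_mono) auto
        also have "\<dots> \<le> 3" by (auto intro!: card_insert_le_m1)
        finally show False using four by simp
      qed
      then have "triangle ?E a b c" using abc by (simp add: triangle_def insert_commute)
      with tf[OF le] show False by blast
    qed
    show False
    proof (cases "\<exists>x. x \<notin> {a, b, c} \<and> {a, x} \<in> ?E")
      case False
      then have touch': "e \<in> {{a, c}, {b, c}, {a, b}} \<or> e \<inter> {a, b} = {}" if "e \<in> ?E" for e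
        using touch[OF that] that by blast
      show False
      proof (cases "\<exists>e\<in>?E. e \<inter> {a, b} = {}")
        case True
        then obtain e where "e \<in> ?E" "e \<inter> {a, b} = {}" by blast
        then have "d \<in> {{a, c}, {b, c}, {a, b}, e}" if "d \<in> ?E" for d
          using touch'[OF that] noN[of d e] that by auto
        then have "?E \<subseteq> {{a, c}, {b, c}, {a, b}, e}" by (rule subsetI)
        then show False by (rule few)
      next
        case False
        then have "d \<in> {{a, c}, {b, c}, {a, b}, {a, c}}" if "d \<in> ?E" for d
          using touch'[OF that] that by auto
        then have "?E \<subseteq> {{a, c}, {b, c}, {a, b}, {a, c}}" by (rule subsetI)
        then show False by (rule few)
      qed
    next
      case True
      then obtain x where x: "x \<notin> {a, b, c}" "{a, x} \<in> ?E" by blast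
      have touch': "d \<in> {{a, c}, {b, c}, {a, b}, {a, x}} \<or> d \<inter> {a, b} = {}" if "d \<in> ?E" for d
        using touch[OF that]
      proof (elim disjE exE conjE)
        fix y assume y: "y \<notin> {a, b, c}" "d = {a, y}"
        then have "y = x" using noQ[of y x] x that by simp
        with y(2) show ?thesis by simp
      qed auto
      show False
      proof (cases "\<exists>e\<in>?E. e \<inter> {a, b} = {}")
        case False
        then have "d \<in> {{a, c}, {b, c}, {a, b}, {a, x}}" if "d \<in> ?E" for d
          using touch'[OF that] that by auto
        then have "?E \<subseteq> {{a, c}, {b, c}, {a, b}, {a, x}}" by (rule subsetI)
        then show False by (rule few)
      next
        case True
        then obtain e where e: "e \<in> ?E" "e \<inter> {a, b} = {}" by blast
        have "d \<in> {{a, c}, {b, c}, {a, b}, {a, x}, e}" if "d \<in> ?E" for d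
          using touch'[OF that] noN[OF that e(1) _ e(2)] by auto
        then have E5: "?E \<subseteq> {{a, c}, {b, c}, {a, b}, {a, x}, e}" by (rule subsetI)
        have E4: "?E = {{a, c}, {b, c}, {a, x}, e}" if "{a, b} \<notin> ?E"
        proof (rule equalityI)
          show "?E \<subseteq> {{a, c}, {b, c}, {a, x}, e}" using E5 that by auto
        qed (use abc x e in simp)
        have le4: "card ?E \<le> 4" if "{a, b} \<notin> ?E"
          unfolding E4[OF that] by (auto intro!: card_insert_le_m1)
        obtain u v where uv: "e = {u, v}" "u \<noteq> v" "u \<notin> {a, b}" "v \<notin> {a, b}"
          using pair[OF e(1)] e(2) by blast
        have cz: False if "{c, z} \<in> ?E" "z \<notin> {a, b, c, x}" for z
          using no_leaves[of b z c "{a, c}" "{a, x}"]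
            that abc x by (auto simp: insert_commute doubleton_eq_iff)
        have xz: False if "{x, z} \<in> ?E" "z \<notin> {a, b, c, x}" for z
          using no_star[of c x a b z] that abc x by (auto simp: insert_commute)
        \<comment> \<open>The edge \<open>{a, b}\<close> may or may not be present. If
          \<open>e\<close> avoids \<open>c\<close> and \<open>x\<close>, these two are twins at
          \<open>a\<close> when \<open>{a, b}\<close> is present, and otherwise the graph is the
          excluded one. If \<open>e = {c, x}\<close>, there is a 4-cycle \<open>b, c, x, a\<close>,
          which contains \<open>star\<close>, or else a triangle in a graph with four edges.\<close>
        consider "e \<inter> {c, x} = {}" | "e = {c, x}" | z where "e = {c, z}" "z \<notin> {a, b, c, x}"
          | z where "e = {x, z}" "z \<notin> {a, b, c, x}"
          using uv by (auto simp: insert_commute doubleton_eq_iff)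
        then show False
        proof cases
          case 1
          show False
          proof (cases "{a, b} \<in> ?E")
            case True
            then show False using no_leaves[of c x a e "{a, b}"] 1 abc x e by (auto simp: insert_commute)
          next
            case False
            have ne: "distinct [a, b, c, x, u, v]" using 1 abc x uv by auto
            have "?E = {{b, c}, {c, a}, {a, x}, {u, v}}"
              using E4[OF False] uv(1) by (simp add: insert_commute)
            with no path3_path1_iso[OF H ne] show False by (elim notE)
          qed
        next
          case 2
          show False
          proof (cases "{a, b} \<in> ?E")
            case True
            then show False using no_star[of b x c a a] 2 abc x e by (auto simp: insert_commute)
          next
            case False
            have "triangle ?E a c x" using 2 abc x e by (auto simp: triangle_def insert_commute)
            with tf[OF le4[OF False], of a c x] show False by (elim notE)
          qed
        next
          case 3
          then show False using cz[of z] e(1) by simp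
        next
          case 4
          then show False using xz[of z] e(1) by simp
        qed
      qed
    qed
  qed
  show False
  proof (cases "\<forall>e\<in>?E. \<forall>e'\<in>?E. e \<noteq> e' \<longrightarrow> e \<inter> e' = {}")
    case True
    obtain F where F: "F \<subseteq> ?E" "card F = 4" using obtain_subset_with_card_n[OF four] by metis
    then obtain e1 e2 e3 e4 where "F = {e1, e2, e3, e4}" "distinct [e1, e2, e3, e4]"
      by (auto simp: numeral_eq_Suc card_Suc_eq)
    then show False by (intro no_matching[of e1 e2 e3 e4]) (use F True in auto)
  next
    case False
    then obtain e e' c where e: "e \<in> ?E" "e' \<in> ?E" "e \<noteq> e'" "c \<in> e" "c \<in> e'" by blast
    have "e \<in> nsets (verts H) 2" "e' \<in> nsets (verts H) 2" using H e by (auto simp: sgraph_def)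
    with e(4,5) obtain a b where a: "e = {c, a}" "c \<noteq> a" and b: "e' = {c, b}" "c \<noteq> b"
      by (metis nsets_2_memE)
    then have ac: "{a, c} \<in> ?E" "{b, c} \<in> ?E" using e(1,2) by (simp_all add: insert_commute)
    have "a \<noteq> b" using e(3) a b by auto
    show False
    proof (cases "\<exists>y. y \<notin> {a, b, c} \<and> {b, y} \<in> ?E")
      case False
      then show False using core[of a b c] \<open>a \<noteq> b\<close> a(2) b(2) ac by auto
    next
      case True
      then obtain y where y: "y \<notin> {a, b, c}" "{b, y} \<in> ?E" by blast
      then have "{a, x} \<notin> ?E" if "x \<notin> {a, b, c}" for x
        using no_star[of a b c x y] that \<open>a \<noteq> b\<close> a(2) b(2) ac y by auto
      then show False using core[of b a c] \<open>a \<noteq> b\<close> a(2) b(2) ac by auto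
    qed
  qed
qed

section \<open>Rainbow copies of graphs with few edges\<close>

context
  fixes n d p :: nat and dg :: "nat \<Rightarrow> nat \<Rightarrow> nat" and h :: "nat \<Rightarrow> nat \<Rightarrow> nat \<Rightarrow> 'c" and V :: "nat set"
  assumes dg: "digits n d p dg" and V: "V \<subseteq> {..<n}"
    and h: "pair_separating n h"
begin

lemma rainbow_paw_subset:
  assumes "distinct [a, b, c, x]" "{a, b, c, x} \<subseteq> V"
    and "E \<subseteq> {{a, b}, {b, c}, {c, a}, {c, x}}"
  shows "\<exists>u\<in>V. inj_on (vertex_colouring dg h u) E"
proof -
  have "\<exists>u\<in>{a, b, c, x}. inj_on (vertex_colouring dg h u) {{a, b}, {b, c}, {c, a}, {c, x}}"
    using assms(1,2) V by (intro rainbow_paw[OF dg _ _ _ _ _ h]) auto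
  with assms(2,3) show ?thesis by (meson inj_on_subset subsetD)
qed

text \<open>After rotating the triangle, the extra edge is disjoint from it, hangs at its third
  vertex, or is one of its sides.\<close>

lemma rainbow_triangle_plus_edge:
  assumes abc: "distinct [a, b, c]" "{a, b, c} \<subseteq> V" and e: "e \<in> nsets V 2"
    and E: "E \<subseteq> {{a, b}, {b, c}, {c, a}, e}"
  shows "\<exists>u\<in>V. inj_on (vertex_colouring dg h u) E"
proof -
  have *: ?thesis if e: "e = {x, y}" "x \<noteq> y" "x \<in> V" "y \<in> V" "y \<notin> {a, b, c}" for x y
  proof -
    consider "x \<notin> {a, b, c}" | "x = a" | "x = b" | "x = c" by blast
    then show ?thesis
    proof cases
      case 1
      then have "\<exists>u\<in>{a, b, c}. inj_on (vertex_colouring dg h u) {{a, b}, {b, c}, {c, a}, {x, y}}"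
        using abc e V by (intro rainbow_triangle_edge[OF dg]) auto
      with abc(2) E e(1) show ?thesis by (meson inj_on_subset subsetD)
    next
      case 2
      have "E \<subseteq> {{b, c}, {c, a}, {a, b}, {a, y}}" using E e(1) 2 by blast
      then show ?thesis using abc e by (intro rainbow_paw_subset) auto
    next
      case 3
      have "E \<subseteq> {{c, a}, {a, b}, {b, c}, {b, y}}" using E e(1) 3 by blast
      then show ?thesis using abc e by (intro rainbow_paw_subset) auto
    next
      case 4
      have "E \<subseteq> {{a, b}, {b, c}, {c, a}, {c, y}}" using E e(1) 4 by blast
      then show ?thesis using abc e by (intro rainbow_paw_subset) auto
    qed
  qed
  from e obtain x y where xy: "e = {x, y}" "x \<noteq> y" "x \<in> V" "y \<in> V" by (rule nsets_2E)
  consider "y \<notin> {a, b, c}" | "x \<notin> {a, b, c}" | "x \<in> {a, b, c}" "y \<in> {a, b, c}" by blast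
  then show ?thesis
  proof cases
    case 1
    with xy show ?thesis by (intro *)
  next
    case 2
    with xy show ?thesis by (intro *[of y x]) auto
  next
    case 3
    with xy have "e \<in> {{a, b}, {b, c}, {c, a}}" by auto
    with E have "E \<subseteq> {{a, b}, {b, c}, {c, a}}" by blast
    moreover have "\<exists>u\<in>{a, b, c}. inj_on (vertex_colouring dg h u) {{a, b}, {b, c}, {c, a}}"
      using abc V by (intro rainbow_triangle[OF dg]) auto
    ultimately show ?thesis using abc(2) by (meson inj_on_subset subsetD)
  qed
qed

text \<open>Two edges that meet are completed to a triangle by a third side, which may lie outside
  \<open>E\<close>.\<close>

lemma rainbow_intersecting:
  assumes "e1 \<in> nsets V 2" "e2 \<in> nsets V 2" "e3 \<in> nsets V 2" "e1 \<noteq> e2" "e1 \<inter> e2 \<noteq> {}"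
    and "E \<subseteq> {e1, e2, e3}"
  shows "\<exists>u\<in>V. inj_on (vertex_colouring dg h u) E"
proof -
  from assms(5) obtain b where b: "b \<in> e1" "b \<in> e2" by blast
  from assms(1) b obtain a where a: "e1 = {a, b}" "a \<noteq> b" "a \<in> V" "b \<in> V"
    by (elim nsets_2E) (auto simp: insert_commute)
  from assms(2) b obtain c where c: "e2 = {b, c}" "b \<noteq> c" "c \<in> V"
    by (elim nsets_2E) (auto simp: insert_commute)
  have "a \<noteq> c" using a c assms(4) by (auto simp: insert_commute)
  with a c assms show ?thesis
    by (intro rainbow_triangle_plus_edge[of a b c e3]) auto
qed

lemma rainbow_small:
  assumes "finite V" "V \<noteq> {}" and E: "E \<subseteq> nsets V 2"
    and "card E \<le> 3 \<or> card E = 4 \<and> (\<exists>a b c. distinct [a, b, c] \<and> {{a, b}, {b, c}, {c, a}} \<subseteq> E)"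
  shows "\<exists>u\<in>V. inj_on (vertex_colouring dg h u) E"
proof -
  have fin: "finite E" using E assms(1) finite_subset finite_imp_finite_nsets by metis
  from assms(4) consider "card E = 0" | "card E = 1" | "card E = 2" | "card E = 3"
    | a b c where "card E = 4" "distinct [a, b, c]" "{{a, b}, {b, c}, {c, a}} \<subseteq> E"
    by force
  then show ?thesis
  proof cases
    case 1
    then show ?thesis using fin assms(2) by auto
  next
    case 2
    then show ?thesis using assms(2) by (auto simp: card_1_singleton_iff)
  next
    case 3
    then obtain e1 e2 where e: "E = {e1, e2}" "e1 \<noteq> e2" by (auto simp: card_2_iff)
    then have e12: "e1 \<in> nsets V 2" "e2 \<in> nsets V 2" using E by auto
    show ?thesis
    proof (cases "e1 \<inter> e2 = {}")
      case False
      with e e12 show ?thesis by (intro rainbow_intersecting[of e1 e2 e1]) auto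
    next
      case True
      from e12(1) obtain a b where a: "e1 = {a, b}" "a \<noteq> b" "a \<in> V" "b \<in> V" by (rule nsets_2E)
      from e12(2) obtain c x where c: "e2 = {c, x}" "c \<noteq> x" "c \<in> V" "x \<in> V" by (rule nsets_2E)
      \<comment> \<open>Two disjoint edges are the side \<open>{a, b}\<close> and the pendant edge
        \<open>{c, x}\<close> of a triangle with a pendant edge.\<close>
      show ?thesis using True a c e by (intro rainbow_paw_subset[of a b c x]) auto
    qed
  next
    case 4
    then obtain e1 e2 e3 where e: "E = {e1, e2, e3}" "e1 \<noteq> e2" "e1 \<noteq> e3" "e2 \<noteq> e3"
      by (auto simp: card_3_iff)
    then have e123: "e1 \<in> nsets V 2" "e2 \<in> nsets V 2" "e3 \<in> nsets V 2" using E by auto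
    consider "e1 \<inter> e2 \<noteq> {}" | "e1 \<inter> e3 \<noteq> {}" | "e2 \<inter> e3 \<noteq> {}"
      | (disj) "e1 \<inter> e2 = {}" "e1 \<inter> e3 = {}" "e2 \<inter> e3 = {}" by blast
    then show ?thesis
    proof cases
      case 1
      with e e123 show ?thesis by (intro rainbow_intersecting[of e1 e2 e3]) auto
    next
      case 2
      with e e123 show ?thesis by (intro rainbow_intersecting[of e1 e3 e2]) auto
    next
      case 3
      with e e123 show ?thesis by (intro rainbow_intersecting[of e2 e3 e1]) auto
    next
      case disj
      from e123(1) obtain a b where a: "e1 = {a, b}" "a \<noteq> b" "a \<in> V" "b \<in> V" by (rule nsets_2E)
      from e123(2) obtain c x where c: "e2 = {c, x}" "c \<noteq> x" "c \<in> V" "x \<in> V" by (rule nsets_2E)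
      from e123(3) obtain y z where y: "e3 = {y, z}" "y \<noteq> z" "y \<in> V" "z \<in> V" by (rule nsets_2E)
      have "\<exists>u\<in>{a, b, c, x, y, z}. inj_on (vertex_colouring dg h u) {{a, b}, {c, x}, {y, z}}"
        using a c y disj V by (intro rainbow_matching[OF dg]) auto
      with a c y e(1) show ?thesis by auto
    qed
  next
    case 5
    have "card {{a, b}, {b, c}, {c, a}} = 3"
      using 5(2) by (auto simp: card_insert_if doubleton_eq_iff)
    then have "card (E - {{a, b}, {b, c}, {c, a}}) = 1"
      using 5(1,3) by (simp add: card_Diff_subset)
    then obtain e where e: "E - {{a, b}, {b, c}, {c, a}} = {e}" by (auto simp: card_1_singleton_iff)
    have "e \<in> E - {{a, b}, {b, c}, {c, a}}" unfolding e by simp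
    then have "e \<in> nsets V 2" using E by auto
    moreover have "{a, b} \<in> nsets V 2" "{b, c} \<in> nsets V 2" using 5(3) E by blast+
    then have "{a, b, c} \<subseteq> V" by (auto simp: nsets_def)
    moreover have "E \<subseteq> {{a, b}, {b, c}, {c, a}} \<union> {e}" unfolding e[symmetric] by auto
    ultimately show ?thesis using 5(2) by (intro rainbow_triangle_plus_edge[of a b c e]) auto
  qed
qed

end

section \<open>Subpolynomial upper bound\<close>

lemma copy_edges:
  assumes H: "sgraph H" and T: "copy_in H (complete_graph n) T"
  shows "verts T \<subseteq> {..<n}" "verts T \<noteq> {}" "edges T \<subseteq> nsets (verts T) 2" "card (edges T) = card (edges H)"
    "\<exists>a b c. triangle (edges H) a b c \<Longrightarrow> \<exists>a b c. triangle (edges T) a b c"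
proof -
  obtain \<phi> where \<phi>: "bij_betw \<phi> (verts H) (verts T)" "(`) \<phi> ` edges H = edges T"
    using T by (auto simp: copy_in_def graph_iso_def)
  show "verts T \<subseteq> {..<n}" "edges T \<subseteq> nsets (verts T) 2"
    using T by (auto simp: copy_in_def subgraph_def complete_graph_def)
  show "verts T \<noteq> {}" using H \<phi>(1) by (auto simp: sgraph_def bij_betw_def)
  have inj: "inj_on \<phi> (verts H)" using \<phi>(1) by (rule bij_betw_imp_inj_on)
  have sub: "e \<subseteq> verts H" if "e \<in> edges H" for e using H that by (auto simp: sgraph_def nsets_def)
  then have "inj_on ((`) \<phi>) (edges H)"
    using inj by (meson inj_on_image_eq_iff inj_onI)
  then show "card (edges T) = card (edges H)" using \<phi>(2) card_image by metis
  assume "\<exists>a b c. triangle (edges H) a b c"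
  then obtain a b c where abc: "triangle (edges H) a b c" by blast
  then have "{a, b} \<subseteq> verts H" "{b, c} \<subseteq> verts H" using sub by (auto simp: triangle_def)
  then have "distinct [\<phi> a, \<phi> b, \<phi> c]" using abc inj by (auto simp: triangle_def inj_on_eq_iff)
  moreover have "\<phi> ` {a, b} \<in> edges T" "\<phi> ` {b, c} \<in> edges T" "\<phi> ` {c, a} \<in> edges T"
    unfolding \<phi>(2)[symmetric] using abc by (auto simp only: triangle_def intro!: imageI)
  ultimately have "triangle (edges T) (\<phi> a) (\<phi> b) (\<phi> c)" by (simp add: triangle_def)
  then show "\<exists>a b c. triangle (edges T) a b c" by blast
qed

definition palette where
  "palette d p = Inl ` ({..<d} \<times> {..<p}) \<union>
     Inr ` (\<lambda>(s, t). {s, t}) `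
       (let W = ({..<d} \<times> {..<p}) \<times> ({..<p} \<times> Pow ({..<d} \<times> {..<d})) in W \<times> W)"

text \<open>Each end of an edge off \<open>u\<close> contributes two factors \<open>p\<close>, a
  branch digit and a value of the polynomial hash. Hence the exponent 4, whatever the depth
  \<open>d\<close>.\<close>

lemma card_palette:
  assumes "p > 0"
  shows "card (palette d p) \<le> (d + (d * 2 ^ (d * d))\<^sup>2) * p ^ 4"
proof -
  let ?W = "({..<d} \<times> {..<p}) \<times> ({..<p} \<times> Pow ({..<d} \<times> {..<d}))"
  have "card (palette d p) \<le> card ({..<d} \<times> {..<p}) + card (?W \<times> ?W)"
    unfolding palette_def Let_def
    by (intro order_trans[OF card_Un_le] add_mono order_trans[OF card_image_le] order_refl)
      (auto intro!: finite_imageI)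
  also have "\<dots> = d * p + (d * 2 ^ (d * d))\<^sup>2 * p ^ 4"
    by (simp add: card_cartesian_product card_Pow power2_eq_square power4_eq_xxxx)
  also have "\<dots> \<le> d * p ^ 4 + (d * 2 ^ (d * d))\<^sup>2 * p ^ 4"
    using assms by (intro add_mono mult_le_mono2) (auto intro: self_le_power)
  finally show ?thesis by (simp add: algebra_simps)
qed

lemma vertex_colouring_in_palette:
  assumes dg: "digits n d p dg" and h: "\<forall>x y z. h x y z \<in> {..<p} \<times> Pow ({..<d} \<times> {..<d})"
    and "u < n" and e: "e \<in> nsets {..<n} 2"
  shows "vertex_colouring dg h u e \<in> palette d p"
proof -
  have br: "branch dg u x \<in> {..<d} \<times> {..<p}" if "u \<noteq> x" "x < n" for x
    using first_diff(1)[OF dg \<open>u < n\<close> that(2,1)]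
      dg that by (auto simp: branch_def digits_def)
  from e obtain x y where xy: "e = {x, y}" "x \<noteq> y" "x < n" "y < n" by (elim nsets_2E) auto
  consider "u = x" | "u = y" | "u \<noteq> x" "u \<noteq> y" by blast
  then show ?thesis
  proof cases
    case 1
    with xy br[of y] show ?thesis by (auto simp: vertex_colouring_star palette_def)
  next
    case 2
    with xy br[of x] show ?thesis by (auto simp: vertex_colouring_star palette_def)
  next
    case 3
    let ?W = "({..<d} \<times> {..<p}) \<times> ({..<p} \<times> Pow ({..<d} \<times> {..<d}))"
    have "(branch dg u x, h u x y) \<in> ?W" "(branch dg u y, h u y x) \<in> ?W"
      using br[of x] br[of y] h 3 xy by blast+
    then have "{(branch dg u x, h u x y), (branch dg u y, h u y x)} \<in> (\<lambda>(s, t). {s, t}) ` (?W \<times> ?W)"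
      by (intro image_eqI[of _ _ "((branch dg u x, h u x y), (branch dg u y, h u y x))"]) auto
    then show ?thesis
      unfolding palette_def Let_def xy(1) vertex_colouring_pair[OF 3 xy(2)] by blast
  qed
qed

lemma g_le_of_few_edges:
  assumes H: "sgraph H" and E: "card (edges H) \<le> 3 \<or> card (edges H) = 4 \<and> \<not> triangle_free H"
    and p: "prime p"
  shows "g (p ^ d) H \<le> (d + (d * 2 ^ (d * d))\<^sup>2) * p ^ 4"
proof -
  let ?n = "p ^ d"
  obtain dg where dg: "digits ?n d p dg" using digits_exist by blast
  obtain h :: "nat \<Rightarrow> nat \<Rightarrow> nat \<Rightarrow> nat \<times> (nat \<times> nat) set" where
    hr: "\<forall>x y z. h x y z \<in> {..<p} \<times> Pow ({..<d} \<times> {..<d})" and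
    h: "pair_separating ?n h"
    using pair_hash[OF dg p] by blast
  have fin: "finite (palette d p)" by (auto simp: palette_def Let_def)
  then obtain en :: "_ \<Rightarrow> nat" where en: "inj_on en (palette d p)"
    using finite_imp_inj_to_nat_seg by metis
  let ?f = "\<lambda>u e. en (vertex_colouring dg h u e)"
  have pal: "vertex_colouring dg h u e \<in> palette d p" if "u < ?n" "e \<in> nsets {..<?n} 2" for u e
    using vertex_colouring_in_palette[OF dg hr that] .
  have "local_collection ?n H ?f"
    unfolding local_collection_def
  proof (intro allI impI)
    fix T assume T: "copy_in H (complete_graph ?n) T"
    note T' = copy_edges[OF H T]
    have "card (edges T) \<le> 3 \<or> card (edges T) = 4 \<and>
        (\<exists>a b c. distinct [a, b, c] \<and> {{a, b}, {b, c}, {c, a}} \<subseteq> edges T)"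
      using E T'(4,5) triangle_free_iff[OF H] by (auto simp: triangle_def)
    from rainbow_small[OF dg T'(1) h finite_subset[OF T'(1) finite_lessThan] T'(2,3) this]
    obtain u where u: "u \<in> verts T" "inj_on (vertex_colouring dg h u) (edges T)" by blast
    have sub: "vertex_colouring dg h u ` edges T \<subseteq> palette d p"
    proof
      fix s assume "s \<in> vertex_colouring dg h u ` edges T"
      then obtain e where e: "s = vertex_colouring dg h u e" "e \<in> edges T" by blast
      have "u < ?n" "e \<in> nsets {..<?n} 2" using u(1) e(2) T'(1,3) nsets_mono[OF T'(1)] by auto
      then show "s \<in> palette d p" unfolding e(1) by (rule pal)
    qed
    have "inj_on (\<lambda>e. en (vertex_colouring dg h u e)) (edges T)"
      using comp_inj_on[OF u(2) inj_on_subset[OF en sub]]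
      by (simp add: comp_def)
    with u(1) show "\<exists>u\<in>verts T. inj_on (\<lambda>e. en (vertex_colouring dg h u e)) (edges T)" by blast
  qed
  moreover have "uses_at_most ?n ?f (card (palette d p))"
    unfolding uses_at_most_def complete_graph_def graph.sel
  proof
    fix v assume v: "v \<in> {..<?n}"
    have "(\<lambda>e. en (vertex_colouring dg h v e)) ` nsets {..<?n} 2 \<subseteq> en ` palette d p" using pal v by auto
    then have "card ((\<lambda>e. en (vertex_colouring dg h v e)) ` nsets {..<?n} 2) \<le> card (en ` palette d p)"
      using fin by (intro card_mono) auto
    also have "\<dots> \<le> card (palette d p)" using fin by (rule card_image_le)
    finally show "card ((\<lambda>e. en (vertex_colouring dg h v e)) ` nsets {..<?n} 2) \<le> card (palette d p)" .
  qed
  ultimately have "g ?n H \<le> card (palette d p)"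
    unfolding g_def by (intro Least_le) blast
  also have "\<dots> \<le> (d + (d * 2 ^ (d * d))\<^sup>2) * p ^ 4"
    using p by (intro card_palette) (simp add: prime_gt_0_nat)
  finally show ?thesis .
qed

text \<open>As \<open>m\<close> does not depend on \<open>d\<close>, choose \<open>d\<close> with
  \<open>d * b\<close> at least \<open>m + 1\<close>. Along \<open>n = p ^ d\<close> a lower bound
  \<open>c * n powr b\<close> would give \<open>c * p ^ (m + 1) \<le> C d * p ^ m\<close>, which
  fails for large primes \<open>p\<close>.\<close>

lemma not_bigomega_powr:
  fixes G :: "nat \<Rightarrow> nat" and b :: real
  assumes bound: "\<And>d p. prime p \<Longrightarrow> G (p ^ d) \<le> C d * p ^ m" and b: "b > 0"
  shows "(\<lambda>n. real (G n)) \<notin> \<Omega>(\<lambda>n. real n powr b)"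
proof
  assume "(\<lambda>n. real (G n)) \<in> \<Omega>(\<lambda>n. real n powr b)"
  then obtain c where c: "c > 0" and "\<forall>\<^sub>F n in at_top. norm (real (G n)) \<ge> c * norm (real n powr b)"
    by (rule landau_omega.bigE)
  then obtain N where N: "\<And>n. n \<ge> N \<Longrightarrow> c * real n powr b \<le> real (G n)"
    by (auto simp: eventually_at_top_linorder)
  obtain d where d: "real (Suc m) \<le> real d * b"
    using reals_Archimedean3[OF b] by (metis less_imp_le)
  have "d \<noteq> 0" using d by (intro notI) simp
  obtain k :: nat where k: "real (C d) / c < real k" using reals_Archimedean2 by blast
  \<comment> \<open>\<open>p > N\<close> puts \<open>p ^ d\<close> in the range of the lower bound,
    and \<open>p > k\<close> exceeds \<open>C d / c\<close>.\<close>
  obtain p :: nat where p: "prime p" "p > N + k" using bigger_prime by blast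
  have "p \<le> p ^ d" using \<open>d \<noteq> 0\<close> p by (intro self_le_power) auto
  then have "c * real (p ^ d) powr b \<le> real (G (p ^ d))" using p by (intro N) simp
  also have "\<dots> \<le> real (C d * p ^ m)" using bound[OF p(1)] by (simp only: of_nat_le_iff)
  finally have 1: "c * real (p ^ d) powr b \<le> real (C d) * real p ^ m" by simp
  have p0: "real p \<ge> 1" using p by simp
  have "real p ^ Suc m = real p powr real (Suc m)" using p0 by (subst powr_realpow) auto
  also have "\<dots> \<le> real p powr (real d * b)" using d p0 by (rule powr_mono)
  also have "\<dots> = real (p ^ d) powr b" using p0 by (simp add: powr_powr[symmetric] powr_realpow)
  finally have "c * real p ^ Suc m \<le> c * real (p ^ d) powr b" using c by simp
  with 1 have "(c * real p) * real p ^ m \<le> real (C d) * real p ^ m" by (simp add: mult.assoc)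
  then have "c * real p \<le> real (C d)" using p0 by (simp add: mult_le_cancel_right)
  then have "real p \<le> real (C d) / c" using c by (simp add: field_simps)
  with k p(2) show False by linarith
qed

section \<open>Polynomial lower bound\<close>

lemma not_local_collectionI:
  assumes H: "sgraph H" and inj: "inj_on \<phi> (verts H)" and ran: "\<phi> ` verts H \<subseteq> {..<n}"
    and coll: "\<And>x. x \<in> verts H \<Longrightarrow>
      \<exists>e\<in>edges H. \<exists>e'\<in>edges H. e \<noteq> e' \<and> f (\<phi> x) (\<phi> ` e) = f (\<phi> x) (\<phi> ` e')"
  shows "\<not> local_collection n H f"
proof
  assume loc: "local_collection n H f"
  let ?T = "Graph (\<phi> ` verts H) ((`) \<phi> ` edges H)"
  have sub: "e \<subseteq> verts H" "card e = 2" "finite e" if "e \<in> edges H" for e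
    using H that by (auto simp: sgraph_def nsets_def)
  have im: "\<phi> ` e \<in> nsets (\<phi> ` verts H) 2" if "e \<in> edges H" for e
    using sub[OF that] inj by (auto simp: nsets_def card_image inj_on_subset)
  have "nsets (\<phi> ` verts H) 2 \<subseteq> nsets {..<n} 2" by (rule nsets_mono[OF ran])
  with im ran have "subgraph ?T (complete_graph n)"
    by (auto simp: subgraph_def complete_graph_def)
  moreover have "graph_iso H ?T"
    unfolding graph_iso_def using inj by (intro exI[of _ \<phi>]) (auto simp: bij_betw_def)
  ultimately have "copy_in H (complete_graph n) ?T" by (simp add: copy_in_def)
  with loc obtain u where u: "u \<in> verts ?T" "inj_on (f u) (edges ?T)"
    unfolding local_collection_def by blast
  then obtain x where x: "x \<in> verts H" "inj_on (f (\<phi> x)) ((`) \<phi> ` edges H)" by auto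
  from coll[OF x(1)] obtain e e' where e: "e \<in> edges H" "e' \<in> edges H" "e \<noteq> e'"
    "f (\<phi> x) (\<phi> ` e) = f (\<phi> x) (\<phi> ` e')" by blast
  with x(2) have "\<phi> ` e = \<phi> ` e'" by (auto simp: inj_on_def)
  with e show False using inj sub by (metis inj_on_image_eq_iff)
qed

section \<open>Normalised colours and pigeonhole arguments\<close>

definition bounded_colours :: "nat \<Rightarrow> (nat \<Rightarrow> nat set \<Rightarrow> nat) \<Rightarrow> nat \<Rightarrow> bool" where
  "bounded_colours n f K \<longleftrightarrow> (\<forall>v<n. \<forall>e\<in>nsets {..<n} 2. f v e < K)"

lemma bounded_coloursD: "bounded_colours n f K \<Longrightarrow> v < n \<Longrightarrow> x < n \<Longrightarrow> y < n \<Longrightarrow> x \<noteq> y \<Longrightarrow> f v {x, y} < K"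
  by (auto simp: bounded_colours_def nsets_def)

text \<open>Colours may be renamed separately for each vertex, since being rainbow compares colours
  under a single \<open>f u\<close> only.\<close>

lemma bounded_colours_exists:
  assumes loc: "local_collection n H f" and use: "uses_at_most n f k"
  shows "\<exists>f'. local_collection n H f' \<and> bounded_colours n f' k"
proof -
  let ?E = "nsets {..<n} (2::nat)"
  have fin: "finite ?E" by (simp add: finite_imp_finite_nsets)
  have "\<exists>en. inj_on en (f v ` ?E) \<and> en ` (f v ` ?E) \<subseteq> {..<k}" if "v < n" for v
    using use that fin card_le_inj[of "f v ` ?E" "{..<k}"]
    by (auto simp: uses_at_most_def complete_graph_def)
  then obtain en where en: "\<And>v. v < n \<Longrightarrow> inj_on (en v) (f v ` ?E) \<and> en v ` (f v ` ?E) \<subseteq> {..<k}"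
    by metis
  let ?f = "\<lambda>v e. en v (f v e)"
  have "bounded_colours n ?f k" using en by (fastforce simp: bounded_colours_def)
  moreover have "local_collection n H ?f"
    unfolding local_collection_def
  proof (intro allI impI)
    fix T assume T: "copy_in H (complete_graph n) T"
    then obtain u where u: "u \<in> verts T" "inj_on (f u) (edges T)"
      using loc by (auto simp: local_collection_def)
    have sub: "verts T \<subseteq> {..<n}" "edges T \<subseteq> ?E"
      using T by (auto simp: copy_in_def subgraph_def complete_graph_def)
    have "inj_on (en u) (f u ` edges T)"
      using en[of u] u(1) sub by (meson image_mono inj_on_subset lessThan_iff subsetD)
    with u(2) have "inj_on (?f u) (edges T)" by (auto simp: inj_on_def)
    with u(1) show "\<exists>u\<in>verts T. inj_on (?f u) (edges T)" by blast
  qed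
  ultimately show ?thesis by blast
qed

text \<open>To be read with \<open>j\<close> numbering the candidate twins, \<open>X\<close> the
  rest of \<open>H\<close>, \<open>\<psi> j\<close> its placement in the pool and
  \<open>sig j x\<close> the colour of the edge at the twin as seen from the image of
  \<open>x\<close>. The product counts all such records.\<close>

lemma twin_pigeonhole:
  fixes \<psi> sig :: "nat \<Rightarrow> 'a \<Rightarrow> nat"
  assumes "finite X" "M ^ card X * K ^ card X < J"
    and "\<forall>j<J. \<forall>x\<in>X. \<psi> j x < M \<and> sig j x < K"
  shows "\<exists>i j. i < J \<and> j < J \<and> i \<noteq> j \<and> (\<forall>x\<in>X. \<psi> i x = \<psi> j x \<and> sig i x = sig j x)"
proof -
  let ?F = "\<lambda>j. (restrict (\<psi> j) X, restrict (sig j) X)"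
  let ?B = "PiE X (\<lambda>_. {..<M}) \<times> PiE X (\<lambda>_. {..<K})"
  have "?F ` {..<J} \<subseteq> ?B" using assms(3) by auto
  moreover have "finite ?B" using assms(1) by (auto intro: finite_PiE)
  ultimately have "card (?F ` {..<J}) \<le> card ?B" by (intro card_mono)
  also have "card ?B < card {..<J}"
    using assms by (simp add: card_cartesian_product card_PiE)
  finally have "\<not> inj_on ?F {..<J}" by (rule pigeonhole)
  then obtain i j where ij: "i < J" "j < J" "i \<noteq> j" "?F i = ?F j" by (auto simp: inj_on_def)
  have "\<psi> i x = \<psi> j x \<and> sig i x = sig j x" if "x \<in> X" for x
    using ij(4) that by (metis Pair_inject restrict_apply')
  with ij(1-3) show ?thesis by blast
qed

lemma inj_extension:
  assumes "finite X" "finite S" "card X \<le> card S" "inj_on \<psi>0 A" "A \<subseteq> X" "\<psi>0 ` A \<subseteq> S"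
  shows "\<exists>\<psi>. inj_on \<psi> X \<and> \<psi> ` X \<subseteq> S \<and> (\<forall>x\<in>A. \<psi> x = \<psi>0 x)"
proof -
  have "finite A" using assms finite_subset by blast
  then have "card (X - A) \<le> card (S - \<psi>0 ` A)"
    using assms by (simp add: card_Diff_subset card_image)
  then obtain \<psi>1 where \<psi>1: "\<psi>1 ` (X - A) \<subseteq> S - \<psi>0 ` A" "inj_on \<psi>1 (X - A)"
    using card_le_inj[of "X - A" "S - \<psi>0 ` A"] assms by auto
  let ?\<psi> = "\<lambda>x. if x \<in> A then \<psi>0 x else \<psi>1 x"
  have "inj_on ?\<psi> X"
    using \<psi>1 assms(4) unfolding inj_on_def by (auto split: if_splits)
  moreover have "?\<psi> ` X \<subseteq> S" using \<psi>1 assms by auto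
  ultimately show ?thesis by (intro exI[of _ ?\<psi>]) auto
qed

lemma popular_class:
  assumes "finite S" "\<And>x. x \<in> S \<Longrightarrow> F x < (K::nat)" "K * s \<le> card S" "K > 0"
  obtains c where "s \<le> card {x \<in> S. F x = c}"
proof (rule ccontr)
  assume "\<not> thesis"
  with that have less: "card {x \<in> S. F x = c} < s" for c using not_less by blast
  have "S = (\<Union>c<K. {x \<in> S. F x = c})" using assms(2) by auto
  then have "card S \<le> (\<Sum>c<K. card {x \<in> S. F x = c})"
    by (metis card_UN_le finite_lessThan)
  also have "\<dots> < (\<Sum>c<K. s)" using less assms(4) by (intro sum_strict_mono) auto
  finally show False using assms(3) by simp
qed

text \<open>Two of the \<open>K + 1\<close> disjoint edges \<open>{2 * i, 2 * i + 1}\<close>, or of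
  the \<open>K + 1\<close> edges \<open>{0, Suc i}\<close>, share a colour, depending on whether
  \<open>e\<close> and \<open>e'\<close> meet. These need at most \<open>2 * K + 2\<close> vertices,
  and the rest of \<open>X\<close> is placed arbitrarily.\<close>

lemma monochromatic_pair:
  fixes F :: "nat set \<Rightarrow> nat"
  assumes X: "finite X" and e: "e \<in> nsets X 2" "e' \<in> nsets X 2" "e \<noteq> e'"
    and M: "2 * K + 2 + card X \<le> M" and F: "\<And>x y. x < M \<Longrightarrow> y < M \<Longrightarrow> x \<noteq> y \<Longrightarrow> F {x, y} < K"
  obtains \<psi> where "inj_on \<psi> X" "\<psi> ` X \<subseteq> {..<M}" "F (\<psi> ` e) = F (\<psi> ` e')"
proof -
  have ph: "\<exists>i j. i \<le> K \<and> j \<le> K \<and> i \<noteq> j \<and> F (G i) = F (G j)"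
    if "\<And>i. i \<le> K \<Longrightarrow> F (G i) < K" for G
  proof -
    have "(\<lambda>i. F (G i)) ` {..K} \<subseteq> {..<K}" using that by auto
    then have "card ((\<lambda>i. F (G i)) ` {..K}) < card {..K}"
      by (metis card_atMost card_lessThan card_mono finite_lessThan less_Suc_eq_le)
    then have "\<not> inj_on (\<lambda>i. F (G i)) {..K}" by (rule pigeonhole)
    then show ?thesis by (auto simp: inj_on_def)
  qed
  show ?thesis
  proof (cases "e \<inter> e' = {}")
    case True
    from e(1) obtain p q where p: "e = {p, q}" "p \<noteq> q" "p \<in> X" "q \<in> X" by (auto simp: nsets_2_eq)
    from e(2) obtain r s where r: "e' = {r, s}" "r \<noteq> s" "r \<in> X" "s \<in> X" by (auto simp: nsets_2_eq)
    have "\<exists>i j. i \<le> K \<and> j \<le> K \<and> i \<noteq> j \<and> F {2 * i, 2 * i + 1} = F {2 * j, 2 * j + 1}"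
      by (rule ph) (use M in \<open>auto intro!: F\<close>)
    then obtain i j where ij: "i \<le> K" "j \<le> K" "i \<noteq> j" "F {2 * i, 2 * i + 1} = F {2 * j, 2 * j + 1}"
      by blast
    let ?\<psi> = "\<lambda>x. if x = p then 2 * i else if x = q then 2 * i + 1 else if x = r then 2 * j else 2 * j + 1"
    have inj: "inj_on ?\<psi> {p, q, r, s}" using ij p r True by (auto simp: inj_on_def)
    have sub: "card X \<le> card {..<M}" "{p, q, r, s} \<subseteq> X" "?\<psi> ` {p, q, r, s} \<subseteq> {..<M}"
      using p r M ij by auto
    obtain \<psi> where
      \<psi>: "inj_on \<psi> X" "\<psi> ` X \<subseteq> {..<M}" "\<forall>x\<in>{p, q, r, s}. \<psi> x = ?\<psi> x"
      using inj_extension[OF X finite_lessThan sub(1) inj sub(2,3)] by (elim exE conjE)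
    have "F (\<psi> ` e) = F (\<psi> ` e')"
      using \<psi>(3) p r True ij(4) by auto
    with \<psi>(1,2) show ?thesis by (rule that)
  next
    case False
    then obtain p where pe: "p \<in> e" "p \<in> e'" by blast
    from e(1) pe(1) obtain q where q: "e = {p, q}" "p \<noteq> q" "p \<in> X" "q \<in> X" by (rule nsets_2_memE)
    from e(2) pe(2) obtain s where s: "e' = {p, s}" "p \<noteq> s" "p \<in> X" "s \<in> X" by (rule nsets_2_memE)
    have "q \<noteq> s" using e(3) q(1) s(1) by auto
    note p = q s(1,2,4) this
    have "\<exists>i j. i \<le> K \<and> j \<le> K \<and> i \<noteq> j \<and> F {0, Suc i} = F {0, Suc j}"
      by (rule ph) (use M in \<open>auto intro!: F\<close>)
    then obtain i j where ij: "i \<le> K" "j \<le> K" "i \<noteq> j" "F {0, Suc i} = F {0, Suc j}"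
      by blast
    let ?\<psi> = "\<lambda>x. if x = p then 0 else if x = q then Suc i else Suc j"
    have inj: "inj_on ?\<psi> {p, q, s}" using ij p by (auto simp: inj_on_def)
    have sub: "card X \<le> card {..<M}" "{p, q, s} \<subseteq> X" "?\<psi> ` {p, q, s} \<subseteq> {..<M}"
      using p M ij by auto
    obtain \<psi> where
      \<psi>: "inj_on \<psi> X" "\<psi> ` X \<subseteq> {..<M}" "\<forall>x\<in>{p, q, s}. \<psi> x = ?\<psi> x"
      using inj_extension[OF X finite_lessThan sub(1) inj sub(2,3)] by (elim exE conjE)
    have "F (\<psi> ` e) = F (\<psi> ` e')"
      using \<psi>(3) p ij(4) by auto
    with \<psi>(1,2) show ?thesis by (rule that)
  qed
qed

section \<open>Twins that defeat few colours\<close>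

text \<open>One placement of the rest must serve \<open>v\<close> in both roles, as \<open>a\<close>
  and as \<open>b\<close>. The repeated colours avoid edges at the other twin, whose position is not
  yet known.\<close>

definition twin_embedding ::
    "'a graph \<Rightarrow> (nat \<Rightarrow> nat set \<Rightarrow> nat) \<Rightarrow> nat \<Rightarrow> 'a \<Rightarrow> 'a \<Rightarrow> nat \<Rightarrow> ('a \<Rightarrow> nat) \<Rightarrow> bool" where
  "twin_embedding H f M a b v \<psi> \<longleftrightarrow>
     inj_on \<psi> (verts H - {a, b}) \<and> \<psi> ` (verts H - {a, b}) \<subseteq> {..<M} \<and>
     (\<exists>e\<in>edges H. \<exists>e'\<in>edges H. e \<noteq> e' \<and> b \<notin> e \<and> b \<notin> e' \<and>
        f v (\<psi>(a := v) ` e) = f v (\<psi>(a := v) ` e')) \<and>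
     (\<exists>e\<in>edges H. \<exists>e'\<in>edges H. e \<noteq> e' \<and> a \<notin> e \<and> a \<notin> e' \<and>
        f v (\<psi>(b := v) ` e) = f v (\<psi>(b := v) ` e'))"

text \<open>Among the vertices outside the pool, two have the same record. With \<open>a\<close> at
  one and \<open>b\<close> at the other, both see a repeated colour by their own embeddings, which
  agree on \<open>X\<close>; every vertex of \<open>X\<close> sees \<open>{a, c}\<close> and
  \<open>{b, c}\<close> in the same colour.\<close>

lemma twin_vertices_not_local:
  assumes H: "sgraph H" and f: "bounded_colours n f K"
    and ab: "a \<noteq> b" "a \<noteq> c" "b \<noteq> c" "{a, c} \<in> edges H" "{b, c} \<in> edges H"
    and n: "M + M ^ card (verts H - {a, b}) * K ^ card (verts H - {a, b}) < n"
    and ex: "\<And>v. M \<le> v \<Longrightarrow> v < n \<Longrightarrow> \<exists>\<psi>. twin_embedding H f M a b v \<psi>"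
  shows "\<not> local_collection n H f"
proof -
  let ?J = "n - M"
  define X where "X = verts H - {a, b}"
  define \<psi> where "\<psi> j = (SOME \<psi>. twin_embedding H f M a b (M + j) \<psi>)" for j
  have emb: "twin_embedding H f M a b (M + j) (\<psi> j)" if "j < ?J" for j
    using someI_ex[OF ex[of "M + j"]] that unfolding \<psi>_def by auto
  have \<psi>: "inj_on (\<psi> j) X" "\<psi> j ` X \<subseteq> {..<M}"
    and coll_a: "\<exists>e\<in>edges H. \<exists>e'\<in>edges H. e \<noteq> e' \<and> b \<notin> e \<and> b \<notin> e' \<and>
         f (M + j) ((\<psi> j)(a := M + j) ` e) = f (M + j) ((\<psi> j)(a := M + j) ` e')"
    and coll_b: "\<exists>e\<in>edges H. \<exists>e'\<in>edges H. e \<noteq> e' \<and> a \<notin> e \<and> a \<notin> e' \<and>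
         f (M + j) ((\<psi> j)(b := M + j) ` e) = f (M + j) ((\<psi> j)(b := M + j) ` e')"
    if "j < ?J" for j
    using emb[OF that] by (simp_all only: twin_embedding_def X_def)
  have verts: "a \<in> verts H" "b \<in> verts H" "c \<in> verts H" "finite (verts H)"
    using H ab by (auto simp: sgraph_def nsets_def)
  then have c: "c \<in> X" and fin: "finite X" using X_def ab by auto
  have lt: "\<psi> j x < M" if "j < ?J" "x \<in> X" for j x using \<psi>(2)[OF that(1)] that(2) by auto
  have "f (\<psi> j x) {M + j, \<psi> j c} < K" if "j < ?J" "x \<in> X" for j x
    using lt[OF that] lt[OF that(1) c] that(1) by (intro bounded_coloursD[OF f]) auto
  with lt have small: "\<forall>j<?J. \<forall>x\<in>X. \<psi> j x < M \<and> f (\<psi> j x) {M + j, \<psi> j c} < K"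
    by blast
  have "M ^ card X * K ^ card X < ?J" using n by (simp add: X_def)
  from twin_pigeonhole[where \<psi> = \<psi> and sig = "\<lambda>j x. f (\<psi> j x) {M + j, \<psi> j c}", OF fin this small]
  obtain i j where ij: "i < ?J" "j < ?J" "i \<noteq> j"
    and all: "\<forall>x\<in>X. \<psi> i x = \<psi> j x \<and> f (\<psi> i x) {M + i, \<psi> i c} = f (\<psi> j x) {M + j, \<psi> j c}"
    by (elim exE conjE)
  have same: "\<psi> i x = \<psi> j x \<and> f (\<psi> i x) {M + i, \<psi> i c} = f (\<psi> j x) {M + j, \<psi> j c}"
    if "x \<in> X" for x by (rule bspec[OF all that])
  let ?\<phi> = "(\<psi> i)(a := M + i, b := M + j)"
  have V: "verts H = insert a (insert b X)" using X_def verts by auto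
  have out: "a \<notin> X" "b \<notin> X" using X_def by auto
  have edge: "e \<subseteq> insert a (insert b X)" if "e \<in> edges H" for e
    using H that V by (auto simp: sgraph_def nsets_def)
  show ?thesis
  proof (rule not_local_collectionI[OF H, of ?\<phi>])
    show "inj_on ?\<phi> (verts H)"
    proof -
      have "inj_on ?\<phi> X \<longleftrightarrow> inj_on (\<psi> i) X" by (rule inj_on_cong) (use out in auto)
      then have "inj_on ?\<phi> X" using \<psi>(1)[OF ij(1)] by simp
      moreover have "?\<phi> ` X \<subseteq> {..<M}" using lt[OF ij(1)] out by auto
      ultimately show ?thesis unfolding V using ab(1) out ij(3) by (auto simp: inj_on_insert)
    qed
    show "?\<phi> ` verts H \<subseteq> {..<n}" using lt[OF ij(1)] ij out unfolding V by fastforce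
    fix x assume "x \<in> verts H"
    then consider "x = a" | "x = b" | "x \<in> X" using V by blast
    then show "\<exists>e\<in>edges H. \<exists>e'\<in>edges H. e \<noteq> e' \<and> f (?\<phi> x) (?\<phi> ` e) = f (?\<phi> x) (?\<phi> ` e')"
    proof cases
      case 1
      have "?\<phi> ` e = (\<psi> i)(a := M + i) ` e" if "b \<notin> e" for e
        using that by (intro image_cong) auto
      with coll_a[OF ij(1)] 1 ab(1) show ?thesis by (metis fun_upd_other fun_upd_same)
    next
      case 2
      have "?\<phi> ` e = (\<psi> j)(b := M + j) ` e" if "a \<notin> e" "e \<in> edges H" for e
        using that edge[of e] same by (intro image_cong) auto
      with coll_b[OF ij(2)] 2 ab(1) show ?thesis by (metis fun_upd_same)
    next
      case 3
      have "?\<phi> ` {a, c} = {M + i, \<psi> i c}" "?\<phi> ` {b, c} = {M + j, \<psi> j c}"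
        using ab same[OF c] by auto
      moreover have "?\<phi> x = \<psi> i x" "?\<phi> x = \<psi> j x" using 3 out same by auto
      moreover have "{a, c} \<noteq> {b, c}" using ab by auto
      ultimately show ?thesis using ab same[OF 3] by metis
    qed
  qed
qed

text \<open>The rest of \<open>H\<close> is placed inside a large set of pool vertices joined to
  \<open>v\<close> in one colour under \<open>f v\<close>. Both edges at \<open>v\<close> then
  agree, in either role.\<close>

lemma star_twins_not_local:
  assumes H: "sgraph H" and f: "bounded_colours n f K" and K: "K > 0"
    and ab: "distinct [a, b, c]" "{a, c} \<in> edges H" "{b, c} \<in> edges H"
    and x: "x \<notin> {a, b, c}" "{a, x} \<in> edges H" and y: "y \<notin> {a, b, c}" "{b, y} \<in> edges H"
    and M: "K * card (verts H) \<le> M" and n: "M + M ^ card (verts H - {a, b}) * K ^ card (verts H - {a, b}) < n"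
  shows "\<not> local_collection n H f"
proof (rule twin_vertices_not_local[OF H f, of a b c M])
  let ?X = "verts H - {a, b}"
  fix v assume v: "M \<le> v" "v < n"
  have fin: "finite (verts H)" using H by (simp add: sgraph_def)
  have "f v {v, z} < K" if "z \<in> {..<M}" for z using that v by (intro bounded_coloursD[OF f]) auto
  then obtain col where col: "card (verts H) \<le> card {z \<in> {..<M}. f v {v, z} = col}"
    using popular_class[of "{..<M}" "\<lambda>z. f v {v, z}" K "card (verts H)"] M K by auto
  have "card ?X \<le> card (verts H)" using fin by (intro card_mono) auto
  with col have "card ?X \<le> card {z \<in> {..<M}. f v {v, z} = col}" by linarith
  then obtain \<psi> where \<psi>: "\<psi> ` ?X \<subseteq> {z \<in> {..<M}. f v {v, z} = col}" "inj_on \<psi> ?X"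
    using card_le_inj[of ?X "{z \<in> {..<M}. f v {v, z} = col}"] fin by auto
  have "c \<in> ?X" "x \<in> ?X" "y \<in> ?X"
    using H ab x y by (auto simp: sgraph_def nsets_def)
  then have eq: "f v {v, \<psi> c} = col" "f v {v, \<psi> x} = col" "f v {v, \<psi> y} = col" using \<psi>(1) by auto
  then have eq': "f v {\<psi> c, v} = col" "f v {\<psi> x, v} = col" "f v {\<psi> y, v} = col"
    by (simp_all add: insert_commute)
  show "\<exists>\<psi>. twin_embedding H f M a b v \<psi>"
    unfolding twin_embedding_def
  proof (intro exI[of _ \<psi>] conjI)
    show "inj_on \<psi> ?X" "\<psi> ` ?X \<subseteq> {..<M}" using \<psi> by auto
    show "\<exists>e\<in>edges H. \<exists>e'\<in>edges H. e \<noteq> e' \<and> b \<notin> e \<and> b \<notin> e' \<and>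
         f v (\<psi>(a := v) ` e) = f v (\<psi>(a := v) ` e')"
      by (rule bexI[OF _ ab(2)], rule bexI[OF _ x(2)]) (use ab x eq eq' in \<open>auto simp: doubleton_eq_iff\<close>)
    show "\<exists>e\<in>edges H. \<exists>e'\<in>edges H. e \<noteq> e' \<and> a \<notin> e \<and> a \<notin> e' \<and>
         f v (\<psi>(b := v) ` e) = f v (\<psi>(b := v) ` e')"
      by (rule bexI[OF _ ab(3)], rule bexI[OF _ y(2)]) (use ab y eq eq' in \<open>auto simp: doubleton_eq_iff\<close>)
  qed
qed (use ab n in auto)

text \<open>As \<open>e\<close> and \<open>e'\<close> avoid both twins, one pair of equally coloured
  edges inside the pool serves \<open>v\<close> in either role.\<close>

lemma leaf_twins_not_local:
  assumes H: "sgraph H" and f: "bounded_colours n f K"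
    and ab: "distinct [a, b, c]" "{a, c} \<in> edges H" "{b, c} \<in> edges H"
    and e: "e \<in> edges H" "e' \<in> edges H" "e \<noteq> e'" "e \<inter> {a, b} = {}" "e' \<inter> {a, b} = {}"
    and M: "2 * K + 2 + card (verts H) \<le> M"
    and n: "M + M ^ card (verts H - {a, b}) * K ^ card (verts H - {a, b}) < n"
  shows "\<not> local_collection n H f"
proof (rule twin_vertices_not_local[OF H f, of a b c M])
  let ?X = "verts H - {a, b}"
  fix v assume v: "M \<le> v" "v < n"
  have fin: "finite (verts H)" using H by (simp add: sgraph_def)
  have eX: "e \<in> nsets ?X 2" "e' \<in> nsets ?X 2" using H e by (auto simp: sgraph_def nsets_def)
  have "card ?X \<le> card (verts H)" using fin by (intro card_mono) auto
  then have M': "2 * K + 2 + card ?X \<le> M" using M by linarith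
  have "f v {x, y} < K" if "x < M" "y < M" "x \<noteq> y" for x y
    using that v by (intro bounded_coloursD[OF f]) auto
  then obtain \<psi> where \<psi>: "inj_on \<psi> ?X" "\<psi> ` ?X \<subseteq> {..<M}" "f v (\<psi> ` e) = f v (\<psi> ` e')"
    using monochromatic_pair[OF finite_Diff[OF fin] eX e(3) M', of "f v"] by blast
  have "\<psi>(z := w) ` d = \<psi> ` d" if "z \<notin> d" for z w d
    using that by (intro image_cong) auto
  with \<psi> e show "\<exists>\<psi>. twin_embedding H f M a b v \<psi>"
    unfolding twin_embedding_def
    by (intro exI[of _ \<psi>] conjI bexI[of _ e] bexI[of _ e']) auto
qed (use ab n in auto)

text \<open>The twins are \<open>e1\<close> and \<open>e2\<close>, candidates being the pairs
  \<open>M + 2 * j\<close>, \<open>M + 2 * j + 1\<close>. Both ends of a candidate must see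
  \<open>e3\<close> and \<open>e4\<close> alike; after the pigeonhole step the rest of
  \<open>H\<close> sees \<open>e1\<close> and \<open>e2\<close> alike.\<close>

lemma matching_not_local:
  assumes H: "sgraph H" and f: "bounded_colours n f K"
    and e: "{e1, e2, e3, e4} \<subseteq> edges H" "e1 \<inter> e2 = {}" "e1 \<inter> e3 = {}" "e1 \<inter> e4 = {}"
      "e2 \<inter> e3 = {}" "e2 \<inter> e4 = {}" "e3 \<inter> e4 = {}"
    and M: "2 * K\<^sup>2 + 2 + card (verts H) \<le> M"
    and X: "X = verts H - (e1 \<union> e2)"
    and n: "M + 2 * (M ^ card X * K ^ card X + 1) \<le> n"
  shows "\<not> local_collection n H f"
proof -
  define J where "J = M ^ card X * K ^ card X + 1"
  have E: "edges H \<subseteq> nsets (verts H) 2" and fin: "finite (verts H)" "finite X"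
    using H X by (auto simp: sgraph_def)
  have e12: "e1 \<in> nsets (verts H) 2" "e2 \<in> nsets (verts H) 2" using e(1) E by auto
  from e12(1) obtain a a' where a: "e1 = {a, a'}" "a \<noteq> a'" "a \<in> verts H" "a' \<in> verts H"
    by (rule nsets_2E)
  from e12(2) obtain b b' where b: "e2 = {b, b'}" "b \<noteq> b'" "b \<in> verts H" "b' \<in> verts H"
    by (rule nsets_2E)
  have e34: "e3 \<in> nsets X 2" "e4 \<in> nsets X 2"
    using e E X by (auto simp: nsets_def)
  then have "e3 \<noteq> e4" using e(7) by (auto simp: nsets_def)
  have "card X \<le> card (verts H)" using fin X by (intro card_mono) auto
  then have M': "2 * K\<^sup>2 + 2 + card X \<le> M" using M by simp
  let ?v = "\<lambda>j. M + 2 * j" and ?w = "\<lambda>j. M + 2 * j + 1"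
  have lt: "?v j < n" "?w j < n" if "j < J" for j
    using n that by (auto simp: J_def)
  have "\<exists>\<psi>. inj_on \<psi> X \<and> \<psi> ` X \<subseteq> {..<M} \<and> f (?v j) (\<psi> ` e3) = f (?v j) (\<psi> ` e4) \<and>
      f (?w j) (\<psi> ` e3) = f (?w j) (\<psi> ` e4)" if j: "j < J" for j
  proof -
    \<comment> \<open>Two colours as the base \<open>K\<close> digits of one number below
      \<open>K\<^sup>2\<close>, so that a single pigeonhole handles both ends.\<close>
    let ?F = "\<lambda>e. K * f (?v j) e + f (?w j) e"
    have fK: "f (?v j) {x, y} < K" "f (?w j) {x, y} < K" if "x < M" "y < M" "x \<noteq> y" for x y
      using that lt[OF j] by (auto intro!: bounded_coloursD[OF f])
    have F: "?F {x, y} < K\<^sup>2" if "x < M" "y < M" "x \<noteq> y" for x y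
    proof -
      have "?F {x, y} < K * f (?v j) {x, y} + K" using fK(2)[OF that] by simp
      also have "\<dots> = K * Suc (f (?v j) {x, y})" by simp
      also have "\<dots> \<le> K * K" using fK(1)[OF that] by (intro mult_le_mono2) simp
      finally show ?thesis by (simp add: power2_eq_square)
    qed
    obtain \<psi> where \<psi>: "inj_on \<psi> X" "\<psi> ` X \<subseteq> {..<M}" "?F (\<psi> ` e3) = ?F (\<psi> ` e4)"
      using monochromatic_pair[OF fin(2) e34 \<open>e3 \<noteq> e4\<close> M', of ?F] F by blast
    have small: "f (?w j) (\<psi> ` e) < K" if "e \<in> nsets X 2" for e
    proof -
      have "\<psi> ` e \<in> nsets {..<n} 2"
        using that \<psi>(1,2) lt(1)[OF j] by (fastforce simp: nsets_def card_image inj_on_subset)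
      then show ?thesis using f lt(2)[OF j] by (simp add: bounded_colours_def)
    qed
    have eq: "f (?w j) (\<psi> ` e3) = f (?w j) (\<psi> ` e4)"
      using arg_cong[OF \<psi>(3), of "\<lambda>m. m mod K"] small e34 by simp
    with \<psi>(3) have "K * f (?v j) (\<psi> ` e3) = K * f (?v j) (\<psi> ` e4)" by simp
    with small[OF e34(1)] have "f (?v j) (\<psi> ` e3) = f (?v j) (\<psi> ` e4)" by simp
    with \<psi>(1,2) eq show ?thesis by blast
  qed
  then obtain \<psi> where \<psi>: "\<And>j. j < J \<Longrightarrow> inj_on (\<psi> j) X" "\<And>j. j < J \<Longrightarrow> \<psi> j ` X \<subseteq> {..<M}"
    "\<And>j. j < J \<Longrightarrow> f (?v j) (\<psi> j ` e3) = f (?v j) (\<psi> j ` e4)"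
    "\<And>j. j < J \<Longrightarrow> f (?w j) (\<psi> j ` e3) = f (?w j) (\<psi> j ` e4)"
    by metis
  have less: "\<psi> j x < M" if "j < J" "x \<in> X" for j x using \<psi>(2)[OF that(1)] that(2) by auto
  have "f (\<psi> j x) {?v j, ?w j} < K" if "j < J" "x \<in> X" for j x
    using less[OF that] lt[OF that(1)] by (intro bounded_coloursD[OF f]) auto
  with less have small: "\<forall>j<J. \<forall>x\<in>X. \<psi> j x < M \<and> f (\<psi> j x) {?v j, ?w j} < K"
    by blast
  have "M ^ card X * K ^ card X < J" by (simp add: J_def)
  from twin_pigeonhole[where \<psi> = \<psi> and sig = "\<lambda>j x. f (\<psi> j x) {?v j, ?w j}", OF fin(2) this small]
  obtain i j where ij: "i < J" "j < J" "i \<noteq> j"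
    and all: "\<forall>x\<in>X. \<psi> i x = \<psi> j x \<and> f (\<psi> i x) {?v i, ?w i} = f (\<psi> j x) {?v j, ?w j}"
    by (elim exE conjE)
  have same: "\<psi> i x = \<psi> j x \<and> f (\<psi> i x) {?v i, ?w i} = f (\<psi> j x) {?v j, ?w j}"
    if "x \<in> X" for x by (rule bspec[OF all that])
  define \<phi> where "\<phi> = (\<psi> i)(a := ?v i, a' := ?w i, b := ?v j, b' := ?w j)"
  have ne: "a \<noteq> b" "a \<noteq> b'" "a' \<noteq> b" "a' \<noteq> b'" using e(2) a(1) b(1) by auto
  have \<phi>: "\<phi> a = ?v i" "\<phi> a' = ?w i" "\<phi> b = ?v j" "\<phi> b' = ?w j" using a(2) b(2) ne by (auto simp: \<phi>_def)
  have out: "a \<notin> X" "a' \<notin> X" "b \<notin> X" "b' \<notin> X" using X a(1) b(1) by auto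
  have \<phi>X: "\<phi> x = \<psi> i x" if "x \<in> X" for x using that out by (auto simp: \<phi>_def)
  have V: "verts H = insert a (insert a' (insert b (insert b' X)))" using X a b by auto
  have img: "\<phi> ` e = \<psi> i ` e" "\<phi> ` e = \<psi> j ` e" if "e \<in> nsets X 2" for e
    using that \<phi>X same by (auto simp: nsets_def intro!: image_cong)
  have e34H: "e3 \<in> edges H" "e4 \<in> edges H" "e1 \<in> edges H" "e2 \<in> edges H" using e(1) by auto
  have "e1 \<noteq> e2" using e(2) a(1) by auto
  show ?thesis
  proof (rule not_local_collectionI[OF H, of \<phi>])
    have "inj_on \<phi> X" using \<psi>(1)[OF ij(1)] \<phi>X by (simp cong: inj_on_cong)
    moreover have "\<phi> ` X \<subseteq> {..<M}" using less[OF ij(1)] \<phi>X by auto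
    \<comment> \<open>Parity keeps the ends of different candidates apart.\<close>
    moreover have "2 * i \<noteq> Suc (2 * j)" "2 * j \<noteq> Suc (2 * i)" by presburger+
    ultimately show "inj_on \<phi> (verts H)"
      unfolding V using ij(3) by (auto simp: \<phi>)
    show "\<phi> ` verts H \<subseteq> {..<n}"
      unfolding V using less[OF ij(1)] \<phi>X lt[OF ij(1)] lt[OF ij(2)] by (fastforce simp: \<phi>)
    fix x assume "x \<in> verts H"
    then consider "x = a" | "x = a'" | "x = b" | "x = b'" | "x \<in> X" using V by blast
    then have "(f (\<phi> x) (\<phi> ` e3) = f (\<phi> x) (\<phi> ` e4)) \<or> (f (\<phi> x) (\<phi> ` e1) = f (\<phi> x) (\<phi> ` e2))"
    proof cases
      case 5
      have eq: "\<psi> i x = \<psi> j x" "f (\<psi> i x) {?v i, ?w i} = f (\<psi> j x) {?v j, ?w j}"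
        using same[OF 5] by (rule conjunct1) (rule conjunct2[OF same[OF 5]])
      have "\<phi> ` e1 = {?v i, ?w i}" "\<phi> ` e2 = {?v j, ?w j}" by (simp_all add: a(1) b(1) \<phi>)
      with eq show ?thesis using \<phi>X[OF 5] by metis
    next
      case 1
      then show ?thesis using \<psi>(3)[OF ij(1)] img(1)[OF e34(1)] img(1)[OF e34(2)] \<phi>(1) by metis
    next
      case 2
      then show ?thesis using \<psi>(4)[OF ij(1)] img(1)[OF e34(1)] img(1)[OF e34(2)] \<phi>(2) by metis
    next
      case 3
      then show ?thesis using \<psi>(3)[OF ij(2)] img(2)[OF e34(1)] img(2)[OF e34(2)] \<phi>(3) by metis
    next
      case 4
      then show ?thesis using \<psi>(4)[OF ij(2)] img(2)[OF e34(1)] img(2)[OF e34(2)] \<phi>(4) by metis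
    qed
    with e34H \<open>e1 \<noteq> e2\<close> \<open>e3 \<noteq> e4\<close>
    show "\<exists>e\<in>edges H. \<exists>e'\<in>edges H. e \<noteq> e' \<and> f (\<phi> x) (\<phi> ` e) = f (\<phi> x) (\<phi> ` e')" by blast
  qed
qed

section \<open>Pool size and asymptotics\<close>

text \<open>One pool size serves all three configurations; the square is what the matching asks for.
  The exponent comes from \<open>M ^ h * K ^ h\<close>, which is of order
  \<open>K ^ (3 * h)\<close>, with room for \<open>M\<close> itself.\<close>

lemma pool_size_bounds:
  fixes h K s :: nat
  assumes "K \<ge> 1" "s \<le> h"
  defines "M \<equiv> (h + 4) * K\<^sup>2"
  shows "K * h \<le> M" "2 * K + 2 + h \<le> M" "2 * K\<^sup>2 + 2 + h \<le> M"
    "M + 2 * (M ^ s * K ^ s + 1) \<le> (h + 6 + 2 * (h + 4) ^ h) * K ^ (3 * h + 2)"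
proof -
  have K: "K \<le> K\<^sup>2" "1 \<le> K\<^sup>2" using assms(1) by (auto simp: power2_eq_square)
  have h: "h \<le> h * K\<^sup>2" using K(2) by simp
  have M: "M = h * K\<^sup>2 + 4 * K\<^sup>2" by (simp add: M_def algebra_simps)
  have "K * h \<le> h * K\<^sup>2" using mult_le_mono1[OF K(1), of h] by (simp only: mult.commute)
  then show "K * h \<le> M" unfolding M by linarith
  show "2 * K + 2 + h \<le> M" "2 * K\<^sup>2 + 2 + h \<le> M" using K h M by linarith+
  have "M \<ge> 1" using K by (simp add: M)
  then have "M ^ s * K ^ s \<le> M ^ h * K ^ h"
    using assms(1,2) by (intro mult_le_mono power_increasing) auto
  also have "\<dots> = (h + 4) ^ h * K ^ (3 * h)"
    by (simp add: M_def power_mult_distrib power_mult[symmetric] power_add[symmetric] mult.commute add.commute)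
  also have "\<dots> \<le> (h + 4) ^ h * K ^ (3 * h + 2)"
    using assms(1) by (intro mult_le_mono2 power_increasing) auto
  finally have 1: "M ^ s * K ^ s \<le> (h + 4) ^ h * K ^ (3 * h + 2)" .
  have 2: "M \<le> (h + 4) * K ^ (3 * h + 2)"
    unfolding M_def using assms(1) by (intro mult_le_mono2 power_increasing) auto
  have 3: "1 \<le> K ^ (3 * h + 2)" using assms(1) by simp
  have "M + 2 * (M ^ s * K ^ s + 1) \<le>
      (h + 4) * K ^ (3 * h + 2) + 2 * ((h + 4) ^ h * K ^ (3 * h + 2)) + 2 * K ^ (3 * h + 2)"
    using add_mono[OF 2 add_mono[OF mult_le_mono2[OF 1, of 2] mult_le_mono2[OF 3, of 2]]]
    by (simp add: algebra_simps)
  also have "\<dots> = (h + 6 + 2 * (h + 4) ^ h) * K ^ (3 * h + 2)" by (simp add: algebra_simps)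
  finally show "M + 2 * (M ^ s * K ^ s + 1) \<le> (h + 6 + 2 * (h + 4) ^ h) * K ^ (3 * h + 2)" .
qed

lemma bigomega_powr:
  fixes G :: "nat \<Rightarrow> nat"
  assumes bound: "\<And>n. n \<le> C * (G n + 1) ^ m" and "m > 0"
  shows "(\<lambda>n. real (G n)) \<in> \<Omega>(\<lambda>n. real n powr (1 / m))"
proof -
  \<comment> \<open>The 2 absorbs \<open>G n + 1 \<le> 2 * G n\<close>, valid once
    \<open>n > C\<close> forces \<open>G n\<close> to be positive; \<open>C + 1\<close> keeps the
    base positive.\<close>
  define c where "c = 1 / (2 * real (C + 1) powr (1 / m))"
  have c: "c > 0" by (simp add: c_def)
  have "\<forall>\<^sub>F n in at_top. norm (real (G n)) \<ge> c * norm (real n powr (1 / m))"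
    using eventually_gt_at_top[of C]
  proof eventually_elim
    fix n assume n: "C < n"
    have "G n \<noteq> 0"
    proof
      assume "G n = 0"
      with bound[of n] n show False by simp
    qed
    then have "(G n + 1) ^ m \<le> (2 * G n) ^ m" by (intro power_mono) auto
    then have "n \<le> (C + 1) * (2 * G n) ^ m"
      using bound[of n] by (meson le_add1 mult_le_mono order_trans)
    then have "real n \<le> real ((C + 1) * (2 * G n) ^ m)" by (simp only: of_nat_le_iff)
    also have "\<dots> = real (C + 1) * (2 * real (G n)) ^ m" by (simp add: algebra_simps)
    finally have "real n powr (1 / m) \<le> (real (C + 1) * (2 * real (G n)) ^ m) powr (1 / m)"
      by (intro powr_mono2) auto
    also have "\<dots> = real (C + 1) powr (1 / m) * (2 * real (G n))"
      using \<open>m > 0\<close> \<open>G n \<noteq> 0\<close> by (simp add: powr_mult powr_realpow[symmetric] powr_powr)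
    finally show "norm (real (G n)) \<ge> c * norm (real n powr (1 / m))"
      by (simp add: c_def field_simps)
  qed
  with c show ?thesis by (rule landau_omega.bigI)
qed

lemma local_collection_bound:
  assumes H: "sgraph H"
    and no: "\<nexists>m. graph_iso H
      (disjoint_union (disjoint_union (path_graph 3) (path_graph 1)) (empty_graph m))"
    and E: "card (edges H) \<ge> 5 \<or> card (edges H) = 4 \<and> triangle_free H"
    and loc: "local_collection n H f" and k: "uses_at_most n f k"
  shows "n \<le> (card (verts H) + 6 + 2 * (card (verts H) + 4) ^ card (verts H)) *
    (k + 1) ^ (3 * card (verts H) + 2)"
proof (rule ccontr)
  define h where "h = card (verts H)"
  \<comment> \<open>The shift makes \<open>K\<close> positive even for \<open>k = 0\<close>, as the
    pool bounds require.\<close>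
  define K where "K = k + 1"
  define M where "M = (h + 4) * K\<^sup>2"
  assume "\<not> ?thesis"
  then have less: "(h + 6 + 2 * (h + 4) ^ h) * K ^ (3 * h + 2) < n" by (simp add: h_def K_def)
  obtain f' where f': "local_collection n H f'" "bounded_colours n f' k"
    using bounded_colours_exists[OF loc k] by blast
  then have f'K: "bounded_colours n f' K" by (force simp: bounded_colours_def K_def)
  have K: "K \<ge> 1" by (simp add: K_def)
  have le: "card (verts H - A) \<le> h" for A
    using H unfolding h_def sgraph_def by (intro card_mono) auto
  note bounds = pool_size_bounds[OF K le, folded M_def]
  have n2: "M + 2 * (M ^ card (verts H - A) * K ^ card (verts H - A) + 1) \<le> n" for A
    using bounds(4)[of A] less by (meson le_less_trans less_imp_le)
  have n1: "M + M ^ card (verts H - A) * K ^ card (verts H - A) < n" for A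
    using n2[of A] by simp
  from H no E show False
  proof (cases rule: polynomial_configurations)
    case (matching e1 e2 e3 e4)
    then show False
      using matching_not_local[OF H f'K matching, of M "verts H - (e1 \<union> e2)"]
        bounds(3) n2[of "e1 \<union> e2"] f'(1)
      by (simp add: h_def)
  next
    case (star a b c x y)
    then show False
      using star_twins_not_local[OF H f'K _ star, of M] K bounds(1) n1[of "{a, b}"] f'(1)
      by (simp add: h_def)
  next
    case (leaves a b c e e')
    then show False
      using leaf_twins_not_local[OF H f'K leaves, of M] bounds(2) n1[of "{a, b}"] f'(1)
      by (simp add: h_def)
  qed
qed

section \<open>The characterization\<close>

theorem theorem1p10:
  fixes H :: "'a graph"
  assumes "sgraph H"
    and "\<nexists>m. graph_iso H
           (disjoint_union (disjoint_union (path_graph 3) (path_graph 1)) (empty_graph m))"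
  shows "(\<exists>b::real. b > 0 \<and> (\<lambda>n. real (g n H)) \<in> \<Omega>(\<lambda>n. real n powr b)) \<longleftrightarrow>
         (card (edges H) \<ge> 5 \<or> card (edges H) = 4 \<and> triangle_free H)"
proof
  assume "\<exists>b::real. b > 0 \<and> (\<lambda>n. real (g n H)) \<in> \<Omega>(\<lambda>n. real n powr b)"
  then obtain b :: real where b: "b > 0" "(\<lambda>n. real (g n H)) \<in> \<Omega>(\<lambda>n. real n powr b)" by blast
  show "card (edges H) \<ge> 5 \<or> card (edges H) = 4 \<and> triangle_free H"
  proof (rule ccontr)
    assume "\<not> ?thesis"
    then have "card (edges H) \<le> 3 \<or> card (edges H) = 4 \<and> \<not> triangle_free H" by linarith
    then have "(\<lambda>n. real (g n H)) \<notin> \<Omega>(\<lambda>n. real n powr b)"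
      using not_bigomega_powr[OF g_le_of_few_edges[OF assms(1)] b(1)] by blast
    with b(2) show False by contradiction
  qed
next
  assume E: "card (edges H) \<ge> 5 \<or> card (edges H) = 4 \<and> triangle_free H"
  let ?h = "card (verts H)"
  have "n \<le> (?h + 6 + 2 * (?h + 4) ^ ?h) * (g n H + 1) ^ (3 * ?h + 2)" for n
    using g_attained[OF assms(1)] local_collection_bound[OF assms E] by blast
  then have "(\<lambda>n. real (g n H)) \<in> \<Omega>(\<lambda>n. real n powr (1 / (3 * ?h + 2)))"
    by (rule bigomega_powr) simp
  then show "\<exists>b::real. b > 0 \<and> (\<lambda>n. real (g n H)) \<in> \<Omega>(\<lambda>n. real n powr b)"
    by (intro exI[of _ "1 / real (3 * ?h + 2)"]) simp
qed

end
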